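(* Consider the random intersection graph $G(n,m,F)$ defined in the context, with $m=\lfloor\beta n^\alpha\rfloor$ and $p_i=\gamma W_i n^{-(1+\alpha)/2}\wedge 1$, and assume $F$ has finite mean (normalized to $1$). Let $D_i$ be the degree of vertex $i$ in $G(n,m,F)$. Then, as $n\to\infty$: (a) if $\alpha<1$, $D_i$ converges in distribution to the point mass at $0$; (b) if $\alpha=1$, conditionally on $W_i$, $D_i$ converges in distribution to $\sum_{r=1}^{M}Y_r$, where $M\sim\mathrm{Poisson}(\beta\gamma W_i)$ and $Y_1,Y_2,\dots$ are i.i.d. $\mathrm{Poisson}(\gamma)$, all independent; that is, for every fixed value $w>0$ of $W_i$ (other weights i.i.d. $F$), the generating function satisfies $\mathbf E[t^{D_i}]\to \exp\big(\beta\gamma w(e^{\gamma(t-1)}-1)\big)$ for $t\in[0,1]$; (c) if $\alpha>1$, conditionally on $W_i$, $D_i$ converges in distribution to $\mathrm{Poisson}(\beta\gamma^2W_i)$.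
   Context: Model $G(n,m,F)$: fix constants $\alpha,\beta,\gamma>0$ and a probability distribution $F$ on $(0,\infty)$; if $F$ has finite mean it is assumed to have mean $1$. For a positive integer $n$ let $m=\lfloor\beta n^\alpha\rfloor$, let $\mathcal V=\{1,\dots,n\}$ (vertices, "individuals") and $\mathcal A$ a set of $m$ elements ("groups"). Let $W_1,\dots,W_n$ be i.i.d. with distribution $F$ and set $p_i=\gamma W_i n^{-(1+\alpha)/2}\wedge 1$. Conditionally on the weights, form a bipartite graph $B(n,m,F)$ on $\mathcal V\cup\mathcal A$ by including each edge between $i\in\mathcal V$ and $a\in\mathcal A$ independently with probability $p_i$. The graph $G(n,m,F)$ on $\mathcal V$ has an edge between distinct $i,j$ iff some $a\in\mathcal A$ is adjacent to both $i$ and $j$ in $B(n,m,F)$. The parameters $\alpha,\beta,\gamma,F$ do not depend on $n$. *)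

theory Defs
  imports "HOL-Probability.Probability"
begin

definition rig_m :: "real \<Rightarrow> real \<Rightarrow> nat \<Rightarrow> nat" where
  "rig_m \<alpha> \<beta> n = nat \<lfloor>\<beta> * real n powr \<alpha>\<rfloor>"

definition rig_p :: "real \<Rightarrow> real \<Rightarrow> nat \<Rightarrow> real \<Rightarrow> real" where
  "rig_p \<alpha> \<gamma> n w = min (\<gamma> * w * real n powr (-(1 + \<alpha>) / 2)) 1"

text \<open>Probability space of the model on vertices 1..n and groups 0..m-1:
  independent weights (vertex i has weight law Wi, all others law F) and
  independent uniform[0,1] variables U(j,a); conditionally on the weights the
  edge (j,a) of the bipartite graph is present iff U(j,a) < p_j, i.e. independently
  with probability p_j.\<close>
definition rig_space ::
  "real measure \<Rightarrow> real measure \<Rightarrow> nat \<Rightarrow> nat \<Rightarrow> nat \<Rightarrow> ((nat \<Rightarrow> real) \<times> (nat \<times> nat \<Rightarrow> real)) measure"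
  where
  "rig_space F Wi i n m =
     (\<Pi>\<^sub>M j\<in>{1..n}. (if j = i then Wi else F)) \<Otimes>\<^sub>M
     (\<Pi>\<^sub>M e\<in>{1..n} \<times> {..<m}. uniform_measure lborel {0..1::real})"

definition rig_edge :: "real \<Rightarrow> real \<Rightarrow> nat \<Rightarrow> (nat \<Rightarrow> real) \<times> (nat \<times> nat \<Rightarrow> real) \<Rightarrow> nat \<Rightarrow> nat \<Rightarrow> bool"
  where
  "rig_edge \<alpha> \<gamma> n \<omega> j a \<longleftrightarrow> snd \<omega> (j, a) < rig_p \<alpha> \<gamma> n (fst \<omega> j)"

definition rig_degree :: "real \<Rightarrow> real \<Rightarrow> real \<Rightarrow> nat \<Rightarrow> nat \<Rightarrow> (nat \<Rightarrow> real) \<times> (nat \<times> nat \<Rightarrow> real) \<Rightarrow> nat"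
  where
  "rig_degree \<alpha> \<beta> \<gamma> n i \<omega> =
     card {j \<in> {1..n}. j \<noteq> i \<and>
        (\<exists>a < rig_m \<alpha> \<beta> n. rig_edge \<alpha> \<gamma> n \<omega> i a \<and> rig_edge \<alpha> \<gamma> n \<omega> j a)}"

definition rig_degree_law :: "real measure \<Rightarrow> real measure \<Rightarrow> real \<Rightarrow> real \<Rightarrow> real \<Rightarrow> nat \<Rightarrow> nat \<Rightarrow> real measure"
  where
  "rig_degree_law F Wi \<alpha> \<beta> \<gamma> i n =
     distr (rig_space F Wi i n (rig_m \<alpha> \<beta> n)) borel (\<lambda>\<omega>. real (rig_degree \<alpha> \<beta> \<gamma> n i \<omega>))"

end

theory Submission
  imports Defs
begin

text \<open>
  Expanding over the set of groups of \<open>i\<close> gives \<open>E t^D = E (1 - (1 - t) * q (X))^(n - 1)\<close> exactly,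
  where \<open>X\<close> is binomial with parameters \<open>m\<close> and \<open>p\<^sub>i\<close>, and \<open>q k = 1 - E (1 - p)^k\<close> for the edge
  probability \<open>p\<close> of an independent vertex. This holds for complex \<open>t\<close> in the unit disc, so it
  yields characteristic functions as well. With \<open>s = \<gamma> * n powr (-(1 + \<alpha>) / 2)\<close>, replacing
  \<open>1 - (1 - t) * q k\<close> by \<open>(1 - (1 - t) * s)^k\<close> turns the expectation over \<open>X\<close> into the closed form
  \<open>(1 + p\<^sub>i * ((1 - (1 - t) * s)^(n - 1) - 1))^m\<close>, whose limit is elementary. By dominated convergence
  and \<open>n * m * s\<^sup>2 \<longlonglongrightarrow> \<beta> * \<gamma>\<^sup>2\<close>, the error tends to \<open>0\<close> under a first moment assumption only.
  Levy's continuity theorem then gives (a) and (c).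
\<close>

section \<open>Combinatorial expansion of the degree generating function\<close>

lemma sum_Pow_card:
  fixes g :: "nat \<Rightarrow> 'b :: comm_semiring_1"
  assumes "finite A"
  shows "(\<Sum>S\<in>Pow A. g (card S)) = (\<Sum>k\<le>card A. of_nat (card A choose k) * g k)"
proof -
  have "(\<Sum>S\<in>Pow A. g (card S)) = (\<Sum>k\<le>card A. \<Sum>S\<in>{S \<in> Pow A. card S = k}. g (card S))"
    using assms by (intro sum.group[symmetric]) (auto intro: card_mono)
  also have "\<dots> = (\<Sum>k\<le>card A. of_nat (card A choose k) * g k)"
  proof (rule sum.cong[OF refl])
    fix k
    have "(\<Sum>S\<in>{S \<in> Pow A. card S = k}. g (card S)) = (\<Sum>S\<in>{S \<in> Pow A. card S = k}. g k)"
      by (rule sum.cong) auto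
    also have "\<dots> = of_nat (card A choose k) * g k"
      using n_subsets[OF assms, of k] by (simp add: Pow_def)
    finally show "(\<Sum>S\<in>{S \<in> Pow A. card S = k}. g (card S)) = of_nat (card A choose k) * g k" .
  qed
  finally show ?thesis .
qed

text \<open>Contribution of one edge variable to the event that the groups of \<open>i\<close> are
  exactly \<open>S\<close> and no vertex of \<open>T\<close> has a group in \<open>S\<close>. Edges
  that do not matter get the factor 1, so that the product can run over all of
  \<open>V \<times> A\<close>, the index set of the product measure.\<close>

definition edge_factor :: "nat \<Rightarrow> nat set \<Rightarrow> nat set \<Rightarrow> nat \<times> nat \<Rightarrow> complex \<Rightarrow> complex" where
  "edge_factor i S T e x = (if fst e = i then (if snd e \<in> S then x else 1 - x)
     else if fst e \<in> T \<and> snd e \<in> S then 1 - x else 1)"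

text \<open>Multi-affine in the edge probabilities \<open>c\<close>, so that by independence its expectation at the
  edge indicators is its value at the probabilities; \<open>S\<close> ranges over the sets of groups of \<open>i\<close>.\<close>
definition degree_pgf :: "nat set \<Rightarrow> nat \<Rightarrow> nat set \<Rightarrow> complex \<Rightarrow> (nat \<times> nat \<Rightarrow> complex) \<Rightarrow> complex" where
  "degree_pgf V i A t c = (\<Sum>S\<in>Pow A. (\<Prod>a\<in>S. c (i, a)) * (\<Prod>a\<in>A - S. 1 - c (i, a)) *
     (\<Prod>j\<in>V - {i}. t + (1 - t) * (\<Prod>a\<in>S. 1 - c (j, a))))"

text \<open>Multiplying out the product over the other vertices, \<open>T\<close> collects those for
  which the summand with \<open>1 - t\<close> is chosen. Every resulting term is a product of
  functions of a single edge each, which is the form that a product measure integrates factor by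
  factor.\<close>

lemma degree_pgf_expand:
  assumes "finite V" "finite A" "i \<in> V"
  shows "degree_pgf V i A t c = (\<Sum>S\<in>Pow A. \<Sum>T\<in>Pow (V - {i}).
    (1 - t) ^ card T * t ^ card (V - {i} - T) * (\<Prod>e\<in>V \<times> A. edge_factor i S T e (c e)))"
  unfolding degree_pgf_def
proof (rule sum.cong[OF refl])
  fix S assume S: "S \<in> Pow A"
  have fS: "finite S" using S assms finite_subset by auto
  have row_i: "(\<Prod>a\<in>A. edge_factor i S T (i, a) (c (i, a)))
      = (\<Prod>a\<in>S. c (i, a)) * (\<Prod>a\<in>A - S. 1 - c (i, a))" for T
    using S assms by (simp add: edge_factor_def prod.If_cases Int_absorb1 Diff_eq)
  have row_j: "(\<Prod>a\<in>A. edge_factor i S T (j, a) (c (j, a)))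
      = (if j \<in> T then \<Prod>a\<in>S. 1 - c (j, a) else 1)" if "j \<noteq> i" for j T
    using S assms that by (simp add: edge_factor_def prod.If_cases Int_absorb1)
  have rows: "(\<Prod>e\<in>V \<times> A. edge_factor i S T e (c e)) =
     (\<Prod>a\<in>S. c (i, a)) * (\<Prod>a\<in>A - S. 1 - c (i, a)) * (\<Prod>j\<in>T. \<Prod>a\<in>S. 1 - c (j, a))"
    if T: "T \<in> Pow (V - {i})" for T
  proof -
    have "(\<Prod>e\<in>V \<times> A. edge_factor i S T e (c e)) = (\<Prod>j\<in>V. \<Prod>a\<in>A. edge_factor i S T (j, a) (c (j, a)))"
      by (simp add: prod.cartesian_product)
    also have "\<dots> = (\<Prod>a\<in>A. edge_factor i S T (i, a) (c (i, a))) *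
        (\<Prod>j\<in>V - {i}. \<Prod>a\<in>A. edge_factor i S T (j, a) (c (j, a)))"
      using assms by (intro prod.remove) auto
    also have "(\<Prod>j\<in>V - {i}. \<Prod>a\<in>A. edge_factor i S T (j, a) (c (j, a))) =
        (\<Prod>j\<in>V - {i}. if j \<in> T then \<Prod>a\<in>S. 1 - c (j, a) else 1)"
      by (intro prod.cong refl row_j) auto
    also have "\<dots> = (\<Prod>j\<in>T. \<Prod>a\<in>S. 1 - c (j, a))"
      using T assms by (simp add: prod.If_cases Int_absorb1)
    finally show ?thesis by (simp add: row_i)
  qed
  have "(\<Prod>j\<in>V - {i}. t + (1 - t) * (\<Prod>a\<in>S. 1 - c (j, a))) =
      (\<Prod>j\<in>V - {i}. (1 - t) * (\<Prod>a\<in>S. 1 - c (j, a)) + t)"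
    by (simp add: add.commute)
  also have "\<dots> = (\<Sum>T\<in>Pow (V - {i}). (1 - t) ^ card T * (\<Prod>j\<in>T. \<Prod>a\<in>S. 1 - c (j, a)) *
        t ^ card (V - {i} - T))"
    using assms by (subst prod_add) (auto simp: prod.distrib)
  finally show "(\<Prod>a\<in>S. c (i, a)) * (\<Prod>a\<in>A - S. 1 - c (i, a)) *
       (\<Prod>j\<in>V - {i}. t + (1 - t) * (\<Prod>a\<in>S. 1 - c (j, a))) =
       (\<Sum>T\<in>Pow (V - {i}). (1 - t) ^ card T * t ^ card (V - {i} - T) *
         (\<Prod>e\<in>V \<times> A. edge_factor i S T e (c e)))"
    by (simp add: rows sum_distrib_left mult_ac)
qed

text \<open>At 0/1 values a factor of the term for \<open>S\<close> vanishes unless \<open>S\<close>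
  is the actual group set of \<open>i\<close>. In the surviving term a vertex sharing a group with
  \<open>i\<close> contributes \<open>t + (1 - t) * 0\<close>, any other vertex
  \<open>t + (1 - t) * 1\<close>.\<close>

lemma degree_pgf_indicator:
  assumes "finite V" "finite A"
  shows "degree_pgf V i A t (\<lambda>e. of_bool (E e)) =
    t ^ card {j \<in> V. j \<noteq> i \<and> (\<exists>a\<in>A. E (i, a) \<and> E (j, a))}"
proof -
  define S0 where "S0 = {a \<in> A. E (i, a)}"
  have zero: "(\<Prod>a\<in>S. of_bool (E (i, a))) * (\<Prod>a\<in>A - S. 1 - of_bool (E (i, a))) = (of_bool (S = S0) :: complex)"
    if S: "S \<in> Pow A" for S
  proof -
    have "finite S" using S assms finite_subset by auto
    show ?thesis
    proof (cases "S = S0")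
      case True
      then show ?thesis by (auto simp: S0_def)
    next
      case False
      then consider a where "a \<in> S" "\<not> E (i, a)" | a where "a \<in> A - S" "E (i, a)"
        using S by (auto simp: S0_def)
      then show ?thesis
        by cases (use False \<open>finite S\<close> assms in \<open>auto intro!: prod_zero bexI\<close>)
    qed
  qed
  have S0: "S0 \<in> Pow A" "finite S0" using assms by (auto simp: S0_def)
  have "degree_pgf V i A t (\<lambda>e. of_bool (E e)) = (\<Sum>S\<in>Pow A. of_bool (S = S0) *
     (\<Prod>j\<in>V - {i}. t + (1 - t) * (\<Prod>a\<in>S. 1 - of_bool (E (j, a)))))"
    unfolding degree_pgf_def by (intro sum.cong refl) (simp add: zero)
  also have "\<dots> = (\<Sum>S\<in>Pow A. if S = S0 then 
     (\<Prod>j\<in>V - {i}. t + (1 - t) * (\<Prod>a\<in>S. 1 - of_bool (E (j, a)))) else 0)"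
    by (intro sum.cong refl) simp
  also have "\<dots> = (\<Prod>j\<in>V - {i}. t + (1 - t) * (\<Prod>a\<in>S0. 1 - of_bool (E (j, a))))"
    using S0 assms by simp
  also have "\<dots> = (\<Prod>j\<in>V - {i}. if \<exists>a\<in>A. E (i, a) \<and> E (j, a) then t else 1)"
  proof (intro prod.cong refl)
    fix j
    have "(\<Prod>a\<in>S0. 1 - of_bool (E (j, a))) = (if \<exists>a\<in>A. E (i, a) \<and> E (j, a) then 0 else 1 :: complex)"
      using S0 by (auto simp: S0_def intro!: prod_zero bexI)
    then show "t + (1 - t) * (\<Prod>a\<in>S0. 1 - of_bool (E (j, a))) =
        (if \<exists>a\<in>A. E (i, a) \<and> E (j, a) then t else 1)" by (auto simp only: split: if_split) simp_all
  qed
  also have "\<dots> = t ^ card {j \<in> V. j \<noteq> i \<and> (\<exists>a\<in>A. E (i, a) \<and> E (j, a))}"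
  proof -
    have "(V - {i}) \<inter> {j. \<exists>a\<in>A. E (i, a) \<and> E (j, a)} =
      {j \<in> V. j \<noteq> i \<and> (\<exists>a\<in>A. E (i, a) \<and> E (j, a))}" by auto
    then show ?thesis using assms by (simp add: prod.If_cases)
  qed
  finally show ?thesis .
qed

section \<open>Exact formula for the degree generating function\<close>

text \<open>Integration over the edge variables with the weights held fixed; \<open>B j\<close> is
  the event that an edge at \<open>j\<close> is present, the same for all groups. The integrand is
  \<open>degree_pgf\<close> at indicators, and independence lets each term of its expansion be
  integrated edge by edge and then resummed.\<close>

lemma (in prob_space) integral_degree_pgf:
  assumes fin: "finite V" "finite A" "i \<in> V" and B: "\<And>j. B j \<in> events"
  shows "(\<integral>u. t ^ card {j \<in> V. j \<noteq> i \<and> (\<exists>a\<in>A. u (i, a) \<in> B i \<and> u (j, a) \<in> B j)}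
           \<partial>(\<Pi>\<^sub>M e\<in>V \<times> A. M)) = degree_pgf V i A t (\<lambda>(j, a). of_real (prob (B j)))"
proof -
  interpret P: product_sigma_finite "\<lambda>e::nat \<times> nat. M" ..
  define P where "P = (\<Pi>\<^sub>M e\<in>V \<times> A. M)"
  define h where "h S T e x = edge_factor i S T e (of_bool (x \<in> B (fst e)))" for S T e x
  \<comment> \<open>An indicator takes only the values 0 and 1, so \<open>h\<close> is affine in it.
    Integration replaces the indicator by its probability, and as \<open>edge_factor\<close> is
    itself affine in its last argument, \<open>h_val\<close> is again one of its values.\<close>
  have h_eq: "h S T e = (\<lambda>x. edge_factor i S T e 0 + (edge_factor i S T e 1 - edge_factor i S T e 0) * 
      of_real (indicator (B (fst e)) x))" for S T e
    by (auto simp: h_def fun_eq_iff edge_factor_def)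
  have ind: "integrable M (\<lambda>x. complex_of_real (indicator (B j) x))" for j
    using B by (intro integrable_of_real integrable_real_indicator) (auto simp: emeasure_eq_measure)
  have h_int: "integrable M (h S T e)" for S T e
    unfolding h_eq by (intro Bochner_Integration.integrable_add integrable_mult_right ind) auto
  have h_val: "(\<integral>x. h S T e x \<partial>M) = edge_factor i S T e (of_real (prob (B (fst e))))" for S T e
  proof -
    have "(\<integral>x. h S T e x \<partial>M) = edge_factor i S T e 0 + (edge_factor i S T e 1 - edge_factor i S T e 0) * 
      of_real (prob (B (fst e)))"
      unfolding h_eq using ind B
      by (subst Bochner_Integration.integral_add) (auto simp: prob_space)
    then show ?thesis by (auto simp: edge_factor_def)
  qed
  have "(\<integral>u. t ^ card {j \<in> V. j \<noteq> i \<and> (\<exists>a\<in>A. u (i, a) \<in> B i \<and> u (j, a) \<in> B j)} \<partial>P) =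
      (\<integral>u. degree_pgf V i A t (\<lambda>e. of_bool (u e \<in> B (fst e))) \<partial>P)"
    using degree_pgf_indicator[OF fin(1,2), of i t "\<lambda>e. _ e \<in> B (fst e)"] by simp
  also have "\<dots> = (\<integral>u. (\<Sum>S\<in>Pow A. \<Sum>T\<in>Pow (V - {i}). (1 - t) ^ card T * t ^ card (V - {i} - T) *
      (\<Prod>e\<in>V \<times> A. h S T e (u e))) \<partial>P)"
    by (simp add: degree_pgf_expand[OF fin] h_def)
  also have "\<dots> = (\<Sum>S\<in>Pow A. \<Sum>T\<in>Pow (V - {i}). (1 - t) ^ card T * t ^ card (V - {i} - T) *
      (\<integral>u. (\<Prod>e\<in>V \<times> A. h S T e (u e)) \<partial>P))"
    unfolding P_def using fin h_int
    by (subst Bochner_Integration.integral_sum,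
        (intro Bochner_Integration.integrable_sum integrable_mult_right P.product_integrable_prod; simp),
        subst Bochner_Integration.integral_sum,
        (intro integrable_mult_right P.product_integrable_prod; simp)) simp
  also have "\<dots> = (\<Sum>S\<in>Pow A. \<Sum>T\<in>Pow (V - {i}). (1 - t) ^ card T * t ^ card (V - {i} - T) *
      (\<Prod>e\<in>V \<times> A. edge_factor i S T e (of_real (prob (B (fst e))))))"
    unfolding P_def using fin h_int
    by (subst P.product_integral_prod) (auto simp: h_val)
  also have "\<dots> = degree_pgf V i A t (\<lambda>(j, a). of_real (prob (B j)))"
    by (simp add: degree_pgf_expand[OF fin] case_prod_beta)
  finally show ?thesis unfolding P_def .
qed

text \<open>For a negative argument \<open>rig_p\<close> can be negative, while the edge event then
  has probability 0. The truncation gives a true probability at every real weight, although weights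
  are positive only almost everywhere.\<close>

definition edge_prob :: "real \<Rightarrow> real \<Rightarrow> nat \<Rightarrow> real \<Rightarrow> real" where
  "edge_prob \<alpha> \<gamma> n w = max 0 (rig_p \<alpha> \<gamma> n w)"

lemma edge_prob_bounds: "0 \<le> edge_prob \<alpha> \<gamma> n w" "edge_prob \<alpha> \<gamma> n w \<le> 1"
  by (auto simp: edge_prob_def rig_p_def)

lemma rig_p_measurable [measurable]: "rig_p \<alpha> \<gamma> n \<in> borel_measurable borel"
  unfolding rig_p_def by measurable

lemma edge_prob_measurable [measurable]: "edge_prob \<alpha> \<gamma> n \<in> borel_measurable borel"
  unfolding edge_prob_def by measurable

lemma prob_space_unit_interval: "prob_space (uniform_measure lborel {0..1::real})"
  by (rule prob_space_uniform_measure) auto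

lemma unit_interval_lessThan:
  assumes "p \<le> 1"
  shows "measure (uniform_measure lborel {0..1::real}) {..<p} = max 0 p"
proof -
  have "{0..1} \<inter> {..<p} = {0..<p}" using assms by auto
  then show ?thesis by (simp add: max_def)
qed

lemma rig_degree_measurable:
  assumes F: "sets F = sets borel" and Wi: "sets Wi = sets borel" and i: "1 \<le> i" "i \<le> n"
  shows "rig_degree \<alpha> \<beta> \<gamma> n i \<in> measurable (rig_space F Wi i n (rig_m \<alpha> \<beta> n)) (count_space UNIV)"
proof -
  define m where "m = rig_m \<alpha> \<beta> n"
  define P1 where "P1 = (\<Pi>\<^sub>M j\<in>{1..n}. if j = i then Wi else F)"
  define P2 where "P2 = (\<Pi>\<^sub>M e\<in>{1..n} \<times> {..<m}. uniform_measure lborel {0..1::real})"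
  have W: "(\<lambda>\<omega>. fst \<omega> j) \<in> borel_measurable (P1 \<Otimes>\<^sub>M P2)" if "j \<in> {1..n}" for j
  proof -
    have "(\<lambda>w. w j) \<in> measurable P1 (if j = i then Wi else F)"
      unfolding P1_def by (rule measurable_component_singleton[OF that])
    then have "(\<lambda>w. w j) \<in> measurable P1 borel"
      using F Wi by (cases "j = i") (auto cong: measurable_cong_sets)
    from measurable_compose[OF measurable_fst this] show ?thesis .
  qed
  have U: "(\<lambda>\<omega>. snd \<omega> (j, a)) \<in> borel_measurable (P1 \<Otimes>\<^sub>M P2)" if "j \<in> {1..n}" "a < m" for j a
  proof -
    have "(\<lambda>u. u (j, a)) \<in> measurable P2 (uniform_measure lborel {0..1::real})"
      unfolding P2_def by (rule measurable_component_singleton) (use that in auto)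
    then have "(\<lambda>u. u (j, a)) \<in> borel_measurable P2"
      by (auto cong: measurable_cong_sets)
    from measurable_compose[OF measurable_snd this] show ?thesis .
  qed
  have E: "Measurable.pred (P1 \<Otimes>\<^sub>M P2) (\<lambda>\<omega>. rig_edge \<alpha> \<gamma> n \<omega> j a)" if "j \<in> {1..n}" "a < m" for j a
    unfolding rig_edge_def using U[OF that] W[OF that(1)] by measurable
  have Q: "Measurable.pred (P1 \<Otimes>\<^sub>M P2)
      (\<lambda>\<omega>. \<exists>a\<in>{..<m}. rig_edge \<alpha> \<gamma> n \<omega> i a \<and> rig_edge \<alpha> \<gamma> n \<omega> j a)" if "j \<in> {1..n}" for j
    using that i by (intro pred_intros_finite pred_intros_logic E) auto
  have "(\<lambda>\<omega>. card {j. j \<in> {1..n} \<and> j \<noteq> i \<and>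
      (\<exists>a\<in>{..<m}. rig_edge \<alpha> \<gamma> n \<omega> i a \<and> rig_edge \<alpha> \<gamma> n \<omega> j a)}) \<in> measurable (P1 \<Otimes>\<^sub>M P2) (count_space UNIV)"
  proof (rule measurable_card)
    fix j
    show "{\<omega> \<in> space (P1 \<Otimes>\<^sub>M P2). j \<in> {j. j \<in> {1..n} \<and> j \<noteq> i \<and>
      (\<exists>a\<in>{..<m}. rig_edge \<alpha> \<gamma> n \<omega> i a \<and> rig_edge \<alpha> \<gamma> n \<omega> j a)}} \<in> sets (P1 \<Otimes>\<^sub>M P2)"
    proof (cases "j \<in> {1..n} \<and> j \<noteq> i")
      case True
      then show ?thesis using Q[of j] by (simp only: pred_def mem_Collect_eq simp_thms)
    next
      case False
      then have "{\<omega> \<in> space (P1 \<Otimes>\<^sub>M P2). j \<in> {j. j \<in> {1..n} \<and> j \<noteq> i \<and>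
        (\<exists>a\<in>{..<m}. rig_edge \<alpha> \<gamma> n \<omega> i a \<and> rig_edge \<alpha> \<gamma> n \<omega> j a)}} = {}" by blast
      then show ?thesis by (simp only: sets.empty_sets)
    qed
  qed
  also have "(\<lambda>\<omega>. card {j. j \<in> {1..n} \<and> j \<noteq> i \<and>
      (\<exists>a\<in>{..<m}. rig_edge \<alpha> \<gamma> n \<omega> i a \<and> rig_edge \<alpha> \<gamma> n \<omega> j a)}) = rig_degree \<alpha> \<beta> \<gamma> n i"
    by (intro ext) (simp only: rig_degree_def m_def Bex_def lessThan_iff)
  finally show ?thesis unfolding rig_space_def m_def P1_def P2_def .
qed

text \<open>The edge variables are integrated first, then the independent weights one coordinate at
  a time; a term depends on \<open>S\<close> only through \<open>card S\<close>, which yields the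
  binomial sum. Leaving the law \<open>Wi\<close> of the weight of \<open>i\<close> arbitrary covers
  both a random weight and a prescribed one.\<close>

lemma rig_degree_pgf:
  fixes t :: complex and \<alpha> \<beta> \<gamma> :: real
  assumes pF: "prob_space F" and pWi: "prob_space Wi"
    and F: "sets F = sets borel" and Wi: "sets Wi = sets borel" and i: "1 \<le> i" "i \<le> n"
    and t: "norm t \<le> 1"
  defines "m \<equiv> rig_m \<alpha> \<beta> n" and "r \<equiv> edge_prob \<alpha> \<gamma> n"
  shows "(\<integral>\<omega>. t ^ rig_degree \<alpha> \<beta> \<gamma> n i \<omega> \<partial>rig_space F Wi i n m) =
    (\<Sum>k\<le>m. of_real (\<integral>x. Bernstein m k (r x) \<partial>Wi) * (t + (1 - t) * of_real (\<integral>x. (1 - r x) ^ k \<partial>F)) ^ (n - 1))"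
proof -
  define V where "V = {1..n}"
  have V: "finite V" "finite {..<m}" "i \<in> V" "card (V - {i}) = n - 1" using i by (auto simp: V_def)
  define N where "N j = (if j = i then Wi else F)" for j
  define \<nu> where "\<nu> = uniform_measure lborel {0..1::real}"
  interpret \<nu>: prob_space \<nu> unfolding \<nu>_def by (rule prob_space_unit_interval)
  interpret F: prob_space F by fact
  interpret Wi: prob_space Wi by fact
  have pN: "prob_space (N j)" for j using pF pWi by (simp add: N_def)
  interpret N: product_prob_space N V
    using pN by (simp add: product_prob_space_def product_prob_space_axioms_def product_sigma_finite_def
        prob_space_imp_sigma_finite)
  interpret P1: prob_space "Pi\<^sub>M V N" by (rule prob_space_PiM) (rule pN)
  interpret P2: prob_space "Pi\<^sub>M (V \<times> {..<m}) (\<lambda>_. \<nu>)" by (rule prob_space_PiM) unfold_locales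
  interpret P: pair_prob_space "Pi\<^sub>M V N" "Pi\<^sub>M (V \<times> {..<m}) (\<lambda>_. \<nu>)" ..
  have space: "rig_space F Wi i n m = Pi\<^sub>M V N \<Otimes>\<^sub>M Pi\<^sub>M (V \<times> {..<m}) (\<lambda>_. \<nu>)"
    unfolding rig_space_def V_def N_def[abs_def] \<nu>_def ..
  have D: "rig_degree \<alpha> \<beta> \<gamma> n i \<in> measurable (rig_space F Wi i n m) (count_space UNIV)"
    unfolding m_def by (rule rig_degree_measurable[OF F Wi i])
  have int: "integrable (rig_space F Wi i n m) (\<lambda>\<omega>. t ^ rig_degree \<alpha> \<beta> \<gamma> n i \<omega>)"
    unfolding space
  proof (rule P.integrable_const_bound[where B = 1])
    show "(\<lambda>\<omega>. t ^ rig_degree \<alpha> \<beta> \<gamma> n i \<omega>) \<in> borel_measurable (Pi\<^sub>M V N \<Otimes>\<^sub>M Pi\<^sub>M (V \<times> {..<m}) (\<lambda>_. \<nu>))"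
      using measurable_compose[OF D, of "\<lambda>d. t ^ d" borel] by (simp add: space)
  qed (simp add: norm_power t power_le_one)
  \<comment> \<open>Factor of vertex \<open>j\<close> once the edges are integrated out: for
    \<open>i\<close> the probability that its group set is \<open>S\<close>, for any other vertex
    the generating function of the event of meeting \<open>S\<close>.\<close>
  define f where "f S j x = (if j = i then of_real (r x ^ card S * (1 - r x) ^ (m - card S))
      else t + (1 - t) * of_real ((1 - r x) ^ card S))" for S :: "nat set" and j x
  have r01: "0 \<le> r x" "r x \<le> 1" for x unfolding r_def by (rule edge_prob_bounds)+
  have r_meas: "r \<in> borel_measurable F" "r \<in> borel_measurable Wi"
    unfolding r_def using edge_prob_measurable F Wi by (auto cong: measurable_cong_sets)
  note [measurable] = r_meas
  have int_Wi: "integrable Wi (\<lambda>x. r x ^ k * (1 - r x) ^ l)" for k l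
    by (rule Wi.integrable_const_bound[where B = 1])
       (auto simp: r01 abs_mult power_abs intro!: mult_le_one power_le_one)
  have int_F: "integrable F (\<lambda>x. (1 - r x) ^ l)" for l
    by (rule F.integrable_const_bound[where B = 1]) (auto simp: r01 power_abs intro!: power_le_one)
  have int_f: "integrable (N j) (f S j)" for S j
  proof (cases "j = i")
    case True
    have "integrable Wi (\<lambda>x. complex_of_real (r x ^ card S * (1 - r x) ^ (m - card S)))"
      by (intro integrable_of_real int_Wi)
    then show ?thesis using True by (simp only: f_def[abs_def] N_def if_True simp_thms)
  next
    case False
    have "integrable F (\<lambda>x. t + (1 - t) * of_real ((1 - r x) ^ card S))"
      by (intro Bochner_Integration.integrable_add integrable_mult_right integrable_of_real int_F) simp
    then show ?thesis using False by (simp only: f_def[abs_def] N_def if_False simp_thms)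
  qed
  have f_i: "(\<integral>x. f S i x \<partial>N i) = of_real (\<integral>x. r x ^ card S * (1 - r x) ^ (m - card S) \<partial>Wi)" for S
    unfolding f_def N_def if_True by (simp only: simp_thms if_True integral_complex_of_real)
  have f_j: "(\<integral>x. f S j x \<partial>N j) = t + (1 - t) * of_real (\<integral>x. (1 - r x) ^ card S \<partial>F)" if "j \<noteq> i" for S j
  proof -
    have "(\<integral>x. t + (1 - t) * of_real ((1 - r x) ^ card S) \<partial>F) =
        (\<integral>x. t \<partial>F) + (\<integral>x. (1 - t) * of_real ((1 - r x) ^ card S) \<partial>F)"
      by (intro Bochner_Integration.integral_add integrable_mult_right integrable_of_real int_F) simp
    also have "\<dots> = t + (1 - t) * of_real (\<integral>x. (1 - r x) ^ card S \<partial>F)"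
      unfolding integral_mult_right_zero integral_complex_of_real by (simp add: F.prob_space)
    finally show ?thesis using that by (simp only: f_def[abs_def] N_def if_False simp_thms)
  qed
  have inner: "(\<integral>u. t ^ rig_degree \<alpha> \<beta> \<gamma> n i (w, u) \<partial>Pi\<^sub>M (V \<times> {..<m}) (\<lambda>_. \<nu>)) =
     (\<Sum>S\<in>Pow {..<m}. \<Prod>j\<in>V. f S j (w j))" for w
  proof -
    have "(\<integral>u. t ^ rig_degree \<alpha> \<beta> \<gamma> n i (w, u) \<partial>Pi\<^sub>M (V \<times> {..<m}) (\<lambda>_. \<nu>)) =
        (\<integral>u. t ^ card {j \<in> V. j \<noteq> i \<and> (\<exists>a\<in>{..<m}. u (i, a) \<in> {..<rig_p \<alpha> \<gamma> n (w i)} \<and>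
            u (j, a) \<in> {..<rig_p \<alpha> \<gamma> n (w j)})} \<partial>Pi\<^sub>M (V \<times> {..<m}) (\<lambda>_. \<nu>))"
      by (simp add: rig_degree_def rig_edge_def V_def m_def Bex_def)
    also have "\<dots> = degree_pgf V i {..<m} t (\<lambda>(j, a). of_real (measure \<nu> {..<rig_p \<alpha> \<gamma> n (w j)}))"
      by (rule \<nu>.integral_degree_pgf) (use V in \<open>auto simp: \<nu>_def\<close>)
    also have "\<dots> = degree_pgf V i {..<m} t (\<lambda>(j, a). of_real (r (w j)))"
      unfolding \<nu>_def r_def edge_prob_def by (subst unit_interval_lessThan) (auto simp: rig_p_def)
    also have "\<dots> = (\<Sum>S\<in>Pow {..<m}. \<Prod>j\<in>V. f S j (w j))"
      unfolding degree_pgf_def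
    proof (rule sum.cong[OF refl])
      fix S assume S: "S \<in> Pow {..<m}"
      then have "finite S" by (auto intro: finite_subset)
      then have cS: "card ({..<m} - S) = m - card S" using S by (simp add: card_Diff_subset)
      have f_rest: "(\<Prod>j\<in>V - {i}. f S j (w j)) = (\<Prod>j\<in>V - {i}. t + (1 - t) * of_real ((1 - r (w j)) ^ card S))"
        by (rule prod.cong) (auto simp: f_def)
      show "(\<Prod>a\<in>S. case (i, a) of (j, a) \<Rightarrow> of_real (r (w j))) *
         (\<Prod>a\<in>{..<m} - S. 1 - (case (i, a) of (j, a) \<Rightarrow> of_real (r (w j)))) *
         (\<Prod>j\<in>V - {i}. t + (1 - t) * (\<Prod>a\<in>S. 1 - (case (j, a) of (j, a) \<Rightarrow> of_real (r (w j))))) =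
         (\<Prod>j\<in>V. f S j (w j))"
        unfolding prod.remove[OF V(1,3)] f_rest by (simp add: f_def cS)
    qed
    finally show ?thesis .
  qed
  have "(\<integral>\<omega>. t ^ rig_degree \<alpha> \<beta> \<gamma> n i \<omega> \<partial>rig_space F Wi i n m) =
     (\<integral>w. (\<integral>u. t ^ rig_degree \<alpha> \<beta> \<gamma> n i (w, u) \<partial>Pi\<^sub>M (V \<times> {..<m}) (\<lambda>_. \<nu>)) \<partial>Pi\<^sub>M V N)"
    using int unfolding space by (rule P.integral_fst'[symmetric])
  also have "\<dots> = (\<integral>w. (\<Sum>S\<in>Pow {..<m}. \<Prod>j\<in>V. f S j (w j)) \<partial>Pi\<^sub>M V N)"
    by (simp add: inner)
  also have "\<dots> = (\<Sum>S\<in>Pow {..<m}. \<integral>w. (\<Prod>j\<in>V. f S j (w j)) \<partial>Pi\<^sub>M V N)"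
    by (intro Bochner_Integration.integral_sum N.product_integrable_prod int_f V)
  also have "\<dots> = (\<Sum>S\<in>Pow {..<m}. \<Prod>j\<in>V. \<integral>x. f S j x \<partial>N j)"
    by (intro sum.cong refl N.product_integral_prod int_f V)
  also have "\<dots> = (\<Sum>S\<in>Pow {..<m}. of_real (\<integral>x. r x ^ card S * (1 - r x) ^ (m - card S) \<partial>Wi) *
      (t + (1 - t) * of_real (\<integral>x. (1 - r x) ^ card S \<partial>F)) ^ (n - 1))"
  proof (rule sum.cong[OF refl])
    fix S
    have "(\<Prod>j\<in>V - {i}. \<integral>x. f S j x \<partial>N j) =
        (\<Prod>j\<in>V - {i}. t + (1 - t) * of_real (\<integral>x. (1 - r x) ^ card S \<partial>F))"
      by (intro prod.cong refl f_j) auto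
    then show "(\<Prod>j\<in>V. \<integral>x. f S j x \<partial>N j) = of_real (\<integral>x. r x ^ card S * (1 - r x) ^ (m - card S) \<partial>Wi) *
      (t + (1 - t) * of_real (\<integral>x. (1 - r x) ^ card S \<partial>F)) ^ (n - 1)"
      unfolding prod.remove[OF V(1,3)] f_i prod_constant V(4) by (simp only:)
  qed
  also have "\<dots> = (\<Sum>k\<le>card {..<m}. of_nat (card {..<m} choose k) *
      (of_real (\<integral>x. r x ^ k * (1 - r x) ^ (m - k) \<partial>Wi) *
      (t + (1 - t) * of_real (\<integral>x. (1 - r x) ^ k \<partial>F)) ^ (n - 1)))"
    by (rule sum_Pow_card) simp
  also have "\<dots> = (\<Sum>k\<le>m. of_real (\<integral>x. Bernstein m k (r x) \<partial>Wi) *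
      (t + (1 - t) * of_real (\<integral>x. (1 - r x) ^ k \<partial>F)) ^ (n - 1))"
    by (simp add: Bernstein_def mult.assoc)
  finally show ?thesis .
qed

section \<open>Estimates for powers and binomial generating functions\<close>

text \<open>The constant is \<open>k choose 2\<close>: passing from \<open>k\<close> to
  \<open>Suc k\<close> multiplies the remainder by \<open>1 - z\<close>, which does not increase its
  norm, and adds \<open>k * z^2\<close>.\<close>

lemma norm_one_minus_power_bound:
  fixes z :: complex
  assumes "norm (1 - z) \<le> 1"
  shows "norm ((1 - z) ^ k - (1 - of_nat k * z)) \<le> real k * (real k - 1) / 2 * norm z ^ 2"
proof (induction k)
  case (Suc k)
  have "(1 - z) ^ Suc k - (1 - of_nat (Suc k) * z) =
      (1 - z) * ((1 - z) ^ k - (1 - of_nat k * z)) + of_nat k * z ^ 2"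
    by (simp add: algebra_simps power2_eq_square)
  also have "norm \<dots> \<le> norm (1 - z) * norm ((1 - z) ^ k - (1 - of_nat k * z)) + real k * norm z ^ 2"
    by (rule order_trans[OF norm_triangle_ineq]) (simp add: norm_mult norm_power)
  also have "\<dots> \<le> 1 * (real k * (real k - 1) / 2 * norm z ^ 2) + real k * norm z ^ 2"
    using assms Suc by (intro add_right_mono mult_mono) auto
  also have "\<dots> = real (Suc k) * (real (Suc k) - 1) / 2 * norm z ^ 2"
    by (simp add: field_simps)
  finally show ?case .
qed auto

text \<open>The number is a convex combination of 1 and \<open>t\<close>, both in the unit
  disc.\<close>

lemma norm_convex_combination_le_1:
  fixes t :: complex
  assumes "norm t \<le> 1" "0 \<le> x" "x \<le> 1"
  shows "norm (1 - (1 - t) * of_real x) \<le> 1"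
proof -
  have "1 - (1 - t) * of_real x = of_real (1 - x) + t * of_real x"
    by (simp add: algebra_simps)
  also have "norm \<dots> \<le> (1 - x) + norm t * x"
    using assms by (intro order_trans[OF norm_triangle_ineq]) (simp add: norm_mult del: of_real_diff)
  also have "\<dots> \<le> (1 - x) + 1 * x"
    using assms by (intro add_left_mono mult_right_mono) auto
  finally show ?thesis by simp
qed

text \<open>The power is compared with \<open>exp (z n) ^ k n\<close>. From
  \<open>norm (1 + z n) \<le> 1\<close> follows that the real part of \<open>z n\<close> is at most
  0, so both bases lie in the unit disc and the powers differ by at most \<open>k n\<close> times
  the difference of the bases. That difference is quadratic in \<open>z n\<close>, and
  \<open>k n * z n\<close> stays bounded.\<close>

lemma tendsto_one_plus_power_exp:
  fixes z :: "nat \<Rightarrow> complex" and k :: "nat \<Rightarrow> nat"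
  assumes z: "z \<longlonglongrightarrow> 0" and kz: "(\<lambda>n. of_nat (k n) * z n) \<longlonglongrightarrow> L"
    and le: "eventually (\<lambda>n. norm (1 + z n) \<le> 1) sequentially"
  shows "(\<lambda>n. (1 + z n) ^ k n) \<longlonglongrightarrow> exp L"
proof -
  have bound: "norm ((1 + z n) ^ k n - exp (of_nat (k n) * z n)) \<le>
      norm (of_nat (k n) * z n) * norm (z n) * exp (norm (z n))" if "norm (1 + z n) \<le> 1" for n
  proof -
    have "Re (z n) \<le> 0" using that complex_Re_le_cmod[of "1 + z n"] by simp
    then have "norm (exp (z n)) \<le> 1" by simp
    then have "norm ((1 + z n) ^ k n - exp (z n) ^ k n) \<le> k n * norm ((1 + z n) - exp (z n))"
      using that by (intro norm_power_diff) auto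
    also have "norm ((1 + z n) - exp (z n)) \<le> exp (norm (z n)) * norm (z n) ^ 2"
      using Taylor_exp_field[of "z n" 1] by (simp add: norm_minus_commute power2_eq_square)
    finally have "norm ((1 + z n) ^ k n - exp (z n) ^ k n) \<le> k n * (exp (norm (z n)) * norm (z n) ^ 2)"
      by (simp add: mult_left_mono)
    then show ?thesis
      unfolding exp_of_nat_mult norm_mult norm_of_nat
      by (simp add: power2_eq_square mult_ac)
  qed
  have "(\<lambda>n. norm (of_nat (k n) * z n) * norm (z n) * exp (norm (z n))) \<longlonglongrightarrow> norm L * norm (0::complex) * exp (norm (0::complex))"
    by (intro tendsto_intros z kz)
  then have "(\<lambda>n. norm (of_nat (k n) * z n) * norm (z n) * exp (norm (z n))) \<longlonglongrightarrow> 0" by simp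
  then have "(\<lambda>n. (1 + z n) ^ k n - exp (of_nat (k n) * z n)) \<longlonglongrightarrow> 0"
    by (rule Lim_null_comparison[rotated]) (rule eventually_mono[OF le bound])
  from tendsto_add[OF this tendsto_exp[OF kz]] show ?thesis by simp
qed

lemma one_minus_power_Bonferroni:
  fixes x :: real
  assumes "0 \<le> x" "x \<le> 1"
  shows "\<bar>(1 - x) ^ k - (1 - real k * x)\<bar> \<le> (real k * x)\<^sup>2"
proof -
  have "(1 - of_real x) ^ k - (1 - of_nat k * of_real x) = complex_of_real ((1 - x) ^ k - (1 - real k * x))"
    by simp
  then have "\<bar>(1 - x) ^ k - (1 - real k * x)\<bar> = norm ((1 - of_real x) ^ k - (1 - of_nat k * of_real x) :: complex)"
    by (simp only: norm_of_real)
  also have "\<dots> \<le> real k * (real k - 1) / 2 * norm (complex_of_real x) ^ 2"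
  proof (rule norm_one_minus_power_bound)
    show "norm (1 - complex_of_real x) \<le> 1"
      using norm_convex_combination_le_1[of 0 x] assms by simp
  qed
  also have "\<dots> \<le> real k * real k * x\<^sup>2"
  proof -
    have "y * (y - 1) / 2 \<le> y * y" if "0 \<le> y" for y :: real
      using mult_left_mono[of "(y - 1) / 2" y y] that by simp
    from this[of "real k"] have "real k * (real k - 1) / 2 \<le> real k * real k" by simp
    then show ?thesis unfolding norm_of_real power2_abs by (rule mult_right_mono) simp
  qed
  finally show ?thesis by (simp add: power2_eq_square mult_ac)
qed

text \<open>\<open>Bernstein m k p\<close> is the probability of \<open>k\<close> under the binomial
  law with parameters \<open>m\<close> and \<open>p\<close>, so this is the generating function of
  that law.\<close>

lemma sum_Bernstein_power:
  fixes z :: complex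
  shows "(\<Sum>k\<le>m. of_real (Bernstein m k p) * z ^ k) = (1 + of_real p * (z - 1)) ^ m"
proof -
  have "(1 + of_real p * (z - 1)) ^ m = (of_real p * z + (1 - of_real p)) ^ m"
    by (simp add: algebra_simps)
  also have "\<dots> = (\<Sum>k\<le>m. of_nat (m choose k) * (of_real p * z) ^ k * (1 - of_real p) ^ (m - k))"
    by (rule binomial_ring)
  finally show ?thesis by (simp add: Bernstein_def power_mult_distrib mult_ac)
qed

lemma sum_Bernstein_power_real:
  "(\<Sum>k\<le>m. Bernstein m k p * z ^ k) = (1 + p * (z - 1)) ^ m"
proof -
  have "complex_of_real (\<Sum>k\<le>m. Bernstein m k p * z ^ k) = of_real ((1 + p * (z - 1)) ^ m)"
    using sum_Bernstein_power[of m p "of_real z"] by simp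
  then show ?thesis by (simp only: of_real_eq_iff)
qed

text \<open>The mixed binomial probability generating function is compared with a closed form by replacing
  \<open>1 - E (1 - r)^k\<close> by its linearization \<open>k * s\<close>; the first error term stays linear in the
  expectation, so no second moment of the weights enters.\<close>
lemma (in prob_space) binomial_pgf_approx:
  fixes t :: complex and r :: "'a \<Rightarrow> real" and s P :: real
  assumes t: "norm t \<le> 1" and P: "0 \<le> P" "P \<le> 1" and s: "0 \<le> s" "s \<le> 1"
    and r: "\<And>x. 0 \<le> r x" "\<And>x. r x \<le> 1" and r_meas: "r \<in> borel_measurable M" and Er: "expectation r \<le> s"
  shows "norm ((\<Sum>k\<le>m. of_real (Bernstein m k P) * (t + (1 - t) * of_real (\<integral>x. (1 - r x) ^ k \<partial>M)) ^ N)
       - (1 + of_real P * ((1 - (1 - t) * of_real s) ^ N - 1)) ^ m)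
     \<le> 2 * N * (m * P * s - 1 + (\<integral>x. (1 - P * r x) ^ m \<partial>M)) + 2 * N * (m * P * s)\<^sup>2"
proof -
  note [measurable] = r_meas
  define q where "q k = 1 - (\<integral>x. (1 - r x) ^ k \<partial>M)" for k
  have int: "integrable M (\<lambda>x. (1 - r x) ^ k)" for k
    by (rule integrable_const_bound[where B = 1]) (auto simp: r power_abs intro!: power_le_one)
  have int_r: "integrable M r"
    by (rule integrable_const_bound[where B = 1]) (auto simp: r)
  have q0: "0 \<le> q k" for k
  proof -
    have "(\<integral>x. (1 - r x) ^ k \<partial>M) \<le> (\<integral>x. 1 \<partial>M)"
      by (rule integral_mono[OF int]) (auto simp: r power_le_one)
    then show ?thesis by (simp add: q_def prob_space)
  qed
  have q1: "q k \<le> 1" for k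
    unfolding q_def using r by (auto intro!: integral_nonneg)
  \<comment> \<open>Bernoulli's inequality. The sign matters: \<open>k * s - q k\<close> is
    nonnegative, so no modulus is left on it and its binomial average can be computed
    exactly.\<close>
  have q_le: "q k \<le> k * s" for k
  proof -
    have "1 - k * expectation r = (\<integral>x. 1 + real k * (- r x) \<partial>M)"
      using int_r by (simp add: prob_space)
    also have "\<dots> \<le> (\<integral>x. (1 - r x) ^ k \<partial>M)"
      using int_r int
    proof (intro integral_mono)
      show "1 + real k * - r x \<le> (1 - r x) ^ k" for x
        using Bernoulli_inequality[of "- r x" k] r[of x] by simp
    qed auto
    finally show ?thesis using Er mult_left_mono[OF Er, of "real k"] unfolding q_def by simp
  qed
  have a_eq: "t + (1 - t) * of_real (\<integral>x. (1 - r x) ^ k \<partial>M) = 1 - (1 - t) * of_real (q k)" for k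
    by (simp add: q_def algebra_simps)
  have nt: "norm (1 - t) \<le> 2" using norm_triangle_ineq4[of 1 t] t by simp
  define b where "b = 1 - (1 - t) * of_real s"
  have nb: "norm b \<le> 1" unfolding b_def by (rule norm_convex_combination_le_1[OF t s])
  \<comment> \<open>Both bases lie in the unit disc, so the exponent costs only a factor
    \<open>N\<close>. The difference of the bases splits into the gap \<open>k * s - q k\<close> and
    the second-order remainder of \<open>b ^ k\<close>.\<close>
  have term_le: "norm ((1 - (1 - t) * of_real (q k)) ^ N - (b ^ k) ^ N)
      \<le> N * (2 * (k * s - q k) + 2 * (real k * (real k - 1)) * s\<^sup>2)" for k
  proof -
    have "norm ((1 - (1 - t) * of_real (q k)) ^ N - (b ^ k) ^ N) \<le> N * norm ((1 - (1 - t) * of_real (q k)) - b ^ k)"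
      by (intro norm_power_diff norm_convex_combination_le_1 t q0 q1)
         (simp add: norm_power nb power_le_one)
    also have "norm ((1 - (1 - t) * of_real (q k)) - b ^ k) =
       norm ((1 - t) * of_real (k * s - q k) - (b ^ k - (1 - of_nat k * ((1 - t) * of_real s))))"
      by (simp add: algebra_simps)
    also have "\<dots> \<le> norm ((1 - t) * of_real (k * s - q k)) + norm (b ^ k - (1 - of_nat k * ((1 - t) * of_real s)))"
      by (rule norm_triangle_ineq4)
    also have "norm ((1 - t) * of_real (k * s - q k)) \<le> 2 * (k * s - q k)"
      unfolding norm_mult norm_of_real using q_le[of k] mult_right_mono[OF nt, of "k * s - q k"] by simp
    also have "norm (b ^ k - (1 - of_nat k * ((1 - t) * of_real s))) \<le>
        real k * (real k - 1) / 2 * norm ((1 - t) * of_real s) ^ 2"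
      unfolding b_def by (rule norm_one_minus_power_bound) (use nb in \<open>simp add: b_def\<close>)
    also have "\<dots> \<le> real k * (real k - 1) / 2 * (2 * s) ^ 2"
    proof (intro mult_left_mono power_mono)
      show "norm ((1 - t) * of_real s) \<le> 2 * s"
        using nt s by (simp add: norm_mult mult_right_mono)
      show "0 \<le> real k * (real k - 1) / 2" by (cases k) auto
    qed auto
    finally show ?thesis by (simp add: power_mult_distrib mult_left_mono mult.assoc)
  qed
  have Bnn: "0 \<le> Bernstein m k P" for k using P by (simp add: Bernstein_nonneg)
  have "(\<Sum>k\<le>m. of_real (Bernstein m k P) * (t + (1 - t) * of_real (\<integral>x. (1 - r x) ^ k \<partial>M)) ^ N)
       - (1 + of_real P * (b ^ N - 1)) ^ m =
       (\<Sum>k\<le>m. of_real (Bernstein m k P) * ((1 - (1 - t) * of_real (q k)) ^ N - (b ^ k) ^ N))"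
    unfolding sum_Bernstein_power[symmetric] a_eq
    by (simp add: sum_subtractf[symmetric] right_diff_distrib power_mult[symmetric] mult.commute)
  also have "norm \<dots> \<le> (\<Sum>k\<le>m. Bernstein m k P * (N * (2 * (k * s - q k) + 2 * (real k * (real k - 1)) * s\<^sup>2)))"
    by (intro sum_norm_le) (simp only: norm_mult norm_of_real abs_of_nonneg[OF Bnn] mult_left_mono[OF term_le Bnn])
  also have "\<dots> = 2 * N * (s * (\<Sum>k\<le>m. real k * Bernstein m k P) - (\<Sum>k\<le>m. Bernstein m k P * q k))
      + 2 * N * s\<^sup>2 * (\<Sum>k\<le>m. real k * (real k - 1) * Bernstein m k P)"
    by (simp add: sum_distrib_left sum_subtractf[symmetric] sum.distrib[symmetric] algebra_simps del: sum_k_Bernstein)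
  \<comment> \<open>Averaging \<open>(1 - r x) ^ k\<close> over a binomial \<open>k\<close> gives
    \<open>(1 - P * r x) ^ m\<close>; this is the generating function at
    \<open>1 - r x\<close>.\<close>
  also have "(\<Sum>k\<le>m. Bernstein m k P * q k) = 1 - (\<integral>x. (1 - P * r x) ^ m \<partial>M)"
  proof -
    have "(\<Sum>k\<le>m. Bernstein m k P * q k) = 1 - (\<Sum>k\<le>m. Bernstein m k P * (\<integral>x. (1 - r x) ^ k \<partial>M))"
      by (simp add: q_def right_diff_distrib sum_subtractf)
    also have "(\<Sum>k\<le>m. Bernstein m k P * (\<integral>x. (1 - r x) ^ k \<partial>M)) = 
        (\<integral>x. (\<Sum>k\<le>m. Bernstein m k P * (1 - r x) ^ k) \<partial>M)"
      using int by (subst Bochner_Integration.integral_sum) auto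
    finally show ?thesis by (simp add: sum_Bernstein_power_real)
  qed
  also have "s * (\<Sum>k\<le>m. real k * Bernstein m k P) = m * P * s" by simp
  also have "(\<Sum>k\<le>m. real k * (real k - 1) * Bernstein m k P) = real m * (real m - 1) * P\<^sup>2"
    by (rule sum_kk_Bernstein)
  also have "2 * N * s\<^sup>2 * (real m * (real m - 1) * P\<^sup>2) \<le> 2 * N * s\<^sup>2 * (real m * real m * P\<^sup>2)"
    by (intro mult_left_mono mult_right_mono) auto
  also have "2 * N * (m * P * s - (1 - (\<integral>x. (1 - P * r x) ^ m \<partial>M))) + 2 * N * s\<^sup>2 * (real m * real m * P\<^sup>2) =
      2 * N * (m * P * s - 1 + (\<integral>x. (1 - P * r x) ^ m \<partial>M)) + 2 * N * (m * P * s)\<^sup>2"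
    by (simp only: power2_eq_square diff_diff_eq2 mult_ac add_diff_eq diff_add_eq)
  finally show ?thesis unfolding b_def by simp
qed

section \<open>Model parameters and their asymptotics\<close>

locale rig_model = prob_space F for F :: "real measure" +
  fixes \<alpha> \<beta> \<gamma> :: real
  assumes F_sets: "sets F = sets borel"
    and F_pos: "AE x in F. 0 < x"
    and F_int: "integrable F (\<lambda>x. x)"
    and F_mean: "(\<integral>x. x \<partial>F) = 1"
    and \<alpha>_pos: "0 < \<alpha>" and \<beta>_pos: "0 < \<beta>" and \<gamma>_pos: "0 < \<gamma>"
begin

definition m :: "nat \<Rightarrow> nat" where "m n = rig_m \<alpha> \<beta> n"
text \<open>Edge probability per unit of weight before the cap at 1.\<close>

definition s :: "nat \<Rightarrow> real" where "s n = \<gamma> * real n powr (-(1 + \<alpha>) / 2)"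
definition r :: "nat \<Rightarrow> real \<Rightarrow> real" where "r n = edge_prob \<alpha> \<gamma> n"

lemma s_nonneg: "0 \<le> s n"
  using \<gamma>_pos by (simp add: s_def)

lemma r_eq: "r n x = max 0 (min (s n * x) 1)"
  by (simp add: r_def edge_prob_def rig_p_def s_def mult_ac)

lemma r_bounds: "0 \<le> r n x" "r n x \<le> 1"
  by (auto simp: r_eq)

lemma r_le: "0 \<le> x \<Longrightarrow> r n x \<le> s n * x"
  using s_nonneg[of n] by (simp add: r_eq)

lemma r_measurable [measurable]: "r n \<in> borel_measurable F"
  unfolding r_def using edge_prob_measurable F_sets by (auto cong: measurable_cong_sets)

lemma ident_measurable [measurable]: "(\<lambda>x. x) \<in> borel_measurable F"
  by (rule borel_measurable_integrable[OF F_int])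

lemma integrable_r: "integrable F (r n)"
  by (rule integrable_const_bound[where B = 1]) (auto simp: r_bounds)

text \<open>The normalization of \<open>F\<close> to mean 1 makes \<open>s n\<close> the mean of the
  uncapped probability; the cap can make the inequality strict.\<close>

lemma expectation_r_le: "expectation (r n) \<le> s n"
proof -
  have "expectation (r n) \<le> (\<integral>x. s n * x \<partial>F)"
    using F_pos by (intro integral_mono_AE integrable_r integrable_mult_right F_int)
      (auto elim!: eventually_mono intro!: r_le)
  then show ?thesis by (simp add: F_mean)
qed

lemma s_tendsto: "s \<longlonglongrightarrow> 0"
proof -
  have "(\<lambda>n. real n powr (-(1 + \<alpha>) / 2)) \<longlonglongrightarrow> 0"
    by (rule tendsto_neg_powr) (use \<alpha>_pos in \<open>auto simp: filterlim_real_sequentially\<close>)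
  from tendsto_mult_right_zero[OF this, of \<gamma>] show ?thesis by (simp add: s_def[abs_def])
qed

lemma m_ratio_tendsto: "(\<lambda>n. real (m n) / real n powr \<alpha>) \<longlonglongrightarrow> \<beta>"
proof -
  have "(\<lambda>n. real n powr (- \<alpha>)) \<longlonglongrightarrow> 0"
    by (rule tendsto_neg_powr) (use \<alpha>_pos in \<open>auto simp: filterlim_real_sequentially\<close>)
  then have lower: "(\<lambda>n. \<beta> - real n powr (- \<alpha>)) \<longlonglongrightarrow> \<beta>"
    using tendsto_diff[OF tendsto_const[of \<beta>]] by fastforce
  have fl: "\<beta> * real n powr \<alpha> - 1 \<le> m n" "m n \<le> \<beta> * real n powr \<alpha>" for n
  proof -
    have "0 \<le> \<beta> * real n powr \<alpha>" using \<beta>_pos by simp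
    then have "real (m n) = of_int \<lfloor>\<beta> * real n powr \<alpha>\<rfloor>" by (simp add: m_def rig_m_def)
    then show "\<beta> * real n powr \<alpha> - 1 \<le> m n" "m n \<le> \<beta> * real n powr \<alpha>" by linarith+
  qed
  show ?thesis
  proof (rule tendsto_sandwich[OF _ _ lower tendsto_const])
    show "\<forall>\<^sub>F n in sequentially. \<beta> - real n powr (- \<alpha>) \<le> real (m n) / real n powr \<alpha>"
      using eventually_gt_at_top[of 0]
    proof eventually_elim
      case (elim n)
      then have p: "0 < real n powr \<alpha>" by simp
      have "(\<beta> - real n powr (- \<alpha>)) * real n powr \<alpha> = \<beta> * real n powr \<alpha> - 1"
        using elim by (simp add: left_diff_distrib powr_add[symmetric])
      then show ?case using fl(1)[of n] p by (simp only: pos_le_divide_eq)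
    qed
    show "\<forall>\<^sub>F n in sequentially. real (m n) / real n powr \<alpha> \<le> \<beta>"
      using eventually_gt_at_top[of 0] by eventually_elim (simp add: divide_le_eq fl)
  qed
qed

lemma nmss_eq: "0 < n \<Longrightarrow> real n * m n * (s n)\<^sup>2 = \<gamma>\<^sup>2 * (real (m n) / real n powr \<alpha>)"
proof -
  assume n: "0 < n"
  have "(real n powr (-(1 + \<alpha>) / 2))\<^sup>2 = real n powr (- 1) * real n powr (- \<alpha>)"
  proof -
    have "-(1 + \<alpha>) / 2 + -(1 + \<alpha>) / 2 = - 1 + - \<alpha>" by (simp add: field_simps)
    then show ?thesis unfolding power2_eq_square powr_add[symmetric] by (rule arg_cong)
  qed
  then show ?thesis using n
    by (simp add: s_def power_mult_distrib powr_minus_divide)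
qed

text \<open>Up to the cap, and with \<open>n\<close> for \<open>n - 1\<close>, this is the mean
  number of pairs of another vertex and a group shared with a vertex of weight 1. It converges for
  every \<open>\<alpha>\<close>; the regimes differ in its factors \<open>m n * s n\<close> (groups
  per vertex) and \<open>n * s n\<close> (vertices per group).\<close>

lemma nmss_tendsto: "(\<lambda>n. real n * m n * (s n)\<^sup>2) \<longlonglongrightarrow> \<beta> * \<gamma>\<^sup>2"
proof -
  have "(\<lambda>n. \<gamma>\<^sup>2 * (real (m n) / real n powr \<alpha>)) \<longlonglongrightarrow> \<gamma>\<^sup>2 * \<beta>"
    by (intro tendsto_intros m_ratio_tendsto)
  then show ?thesis
    by (rule Lim_transform_eventually[THEN tendsto_eq_rhs])
       (auto intro!: eventually_mono[OF eventually_gt_at_top[of 0]] simp: nmss_eq)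
qed

lemma mss_tendsto: "(\<lambda>n. m n * (s n)\<^sup>2) \<longlonglongrightarrow> 0"
proof -
  have "(\<lambda>n. real n * m n * (s n)\<^sup>2 * inverse (real n)) \<longlonglongrightarrow> \<beta> * \<gamma>\<^sup>2 * 0"
    by (intro tendsto_mult nmss_tendsto lim_inverse_n)
  then show ?thesis
  proof (rule Lim_transform_eventually[THEN tendsto_eq_rhs])
    show "\<forall>\<^sub>F n in sequentially. real n * m n * (s n)\<^sup>2 * inverse (real n) = m n * (s n)\<^sup>2"
      using eventually_gt_at_top[of 0] by eventually_elim simp
  qed simp
qed

lemma ns_eq: "0 < n \<Longrightarrow> n * s n = \<gamma> * real n powr ((1 - \<alpha>) / 2)"
proof -
  assume n: "0 < n"
  have "real n * real n powr (-(1 + \<alpha>) / 2) = real n powr (1 + (-(1 + \<alpha>) / 2))"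
    unfolding powr_add using n by simp
  also have "1 + (-(1 + \<alpha>) / 2) = (1 - \<alpha>) / 2" by (simp add: field_simps)
  finally show ?thesis by (simp add: s_def mult_ac)
qed

lemma ns_tendsto_critical: "\<alpha> = 1 \<Longrightarrow> (\<lambda>n. n * s n) \<longlonglongrightarrow> \<gamma>"
  by (rule tendsto_eventually, rule eventually_mono[OF eventually_gt_at_top[of 0]]) (subst ns_eq, simp_all)

lemma ms_tendsto_critical:
  assumes "\<alpha> = 1"
  shows "(\<lambda>n. m n * s n) \<longlonglongrightarrow> \<beta> * \<gamma>"
proof -
  have "(\<lambda>n. real n * m n * (s n)\<^sup>2 / (n * s n)) \<longlonglongrightarrow> \<beta> * \<gamma>\<^sup>2 / \<gamma>"
    using \<gamma>_pos by (intro tendsto_divide nmss_tendsto ns_tendsto_critical assms) simp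
  then show ?thesis using \<gamma>_pos
    by (rule_tac Lim_transform_eventually[THEN tendsto_eq_rhs])
       (auto intro!: eventually_mono[OF eventually_gt_at_top[of 0]] simp: power2_eq_square s_def)
qed

lemma ns_tendsto_supercritical:
  assumes "1 < \<alpha>"
  shows "(\<lambda>n. n * s n) \<longlonglongrightarrow> 0"
proof -
  have "(\<lambda>n. real n powr ((1 - \<alpha>) / 2)) \<longlonglongrightarrow> 0"
    by (rule tendsto_neg_powr) (use assms in \<open>auto simp: filterlim_real_sequentially\<close>)
  from tendsto_mult_right_zero[OF this, of \<gamma>] show ?thesis
    by (rule Lim_transform_eventually)
       (auto intro!: eventually_mono[OF eventually_gt_at_top[of 0]] simp: ns_eq)
qed

lemma ms_tendsto_subcritical:
  assumes "\<alpha> < 1"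
  shows "(\<lambda>n. m n * s n) \<longlonglongrightarrow> 0"
proof -
  have "(\<lambda>n. real n powr ((\<alpha> - 1) / 2)) \<longlonglongrightarrow> 0"
    by (rule tendsto_neg_powr) (use assms in \<open>auto simp: filterlim_real_sequentially\<close>)
  then have "(\<lambda>n. (real (m n) / real n powr \<alpha>) * (\<gamma> * real n powr ((\<alpha> - 1) / 2))) \<longlonglongrightarrow> \<beta> * (\<gamma> * 0)"
    by (intro tendsto_mult m_ratio_tendsto tendsto_const)
  then show ?thesis
  proof (rule Lim_transform_eventually[THEN tendsto_eq_rhs])
    have "real n powr ((\<alpha> - 1) / 2) = real n powr \<alpha> * real n powr (-(1 + \<alpha>) / 2)" for n :: nat
      unfolding powr_add[symmetric] by (simp add: field_simps)
    then show "\<forall>\<^sub>F n in sequentially. (real (m n) / real n powr \<alpha>) * (\<gamma> * real n powr ((\<alpha> - 1) / 2)) = m n * s n"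
      by (intro eventually_mono[OF eventually_gt_at_top[of 0]]) (simp add: s_def)
  qed simp
qed

section \<open>Vanishing of the approximation errors\<close>

lemma quadratic_error_tendsto: "(\<lambda>n. real n * (m n * (s n)\<^sup>2 * c)\<^sup>2) \<longlonglongrightarrow> 0"
proof -
  have "(\<lambda>n. (real n * m n * (s n)\<^sup>2) * (m n * (s n)\<^sup>2) * c\<^sup>2) \<longlonglongrightarrow> \<beta> * \<gamma>\<^sup>2 * 0 * c\<^sup>2"
    by (intro tendsto_mult nmss_tendsto mss_tendsto tendsto_const)
  then show ?thesis by (simp add: power2_eq_square mult_ac)
qed

text \<open>The bound \<open>n * m * s\<^sup>2 * w * x\<close> is integrable because \<open>n * m * s\<^sup>2\<close> converges, so dominated
  convergence needs only the first moment of \<open>F\<close>.\<close>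
lemma linear_error_tendsto:
  assumes w: "0 < w"
  shows "(\<lambda>n. real n * (m n * r n w * s n - 1 + (\<integral>x. (1 - r n w * r n x) ^ m n \<partial>F))) \<longlonglongrightarrow> 0"
proof -
  \<comment> \<open>Because \<open>F\<close> has mean 1, a factor \<open>x\<close> can be inserted
    in the linear term. The error then becomes the integral of \<open>h n\<close>, which is
    nonnegative at positive weights by Bernoulli's inequality.\<close>
  define h where "h n x = real n * (m n * r n w * s n * x - 1 + (1 - r n w * r n x) ^ m n)" for n x
  have rr: "0 \<le> r n w * r n x" "r n w * r n x \<le> 1" for n x
    using r_bounds by (auto intro: mult_le_one)
  have int: "integrable F (\<lambda>x. (1 - r n w * r n x) ^ m n)" for n
    by (rule integrable_const_bound[where B = 1]) (auto simp: rr power_abs intro!: power_le_one)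
  have h_eq: "(\<integral>x. h n x \<partial>F) = real n * (m n * r n w * s n - 1 + (\<integral>x. (1 - r n w * r n x) ^ m n \<partial>F))" for n
    unfolding h_def using int F_int by (simp add: F_mean prob_space)
  have r_w: "r n w \<le> s n * w" for n using w by (intro r_le) simp
  obtain C where C: "\<And>n. \<bar>real n * m n * (s n)\<^sup>2\<bar> \<le> C"
    using convergent_imp_Bseq[OF convergentI[OF nmss_tendsto]] unfolding Bseq_def real_norm_def by blast
  have bound: "norm (h n x) \<le> C * w * x" if x: "0 < x" for n x
  proof -
    have "r n w * r n x \<le> r n w * (s n * x)"
      using x r_bounds by (intro mult_left_mono r_le) auto
    then have "real (m n) * (r n w * r n x) \<le> m n * (r n w * (s n * x))"
      by (rule mult_left_mono) simp
    moreover have "1 - real (m n) * (r n w * r n x) \<le> (1 - r n w * r n x) ^ m n"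
      using Bernoulli_inequality[of "- (r n w * r n x)" "m n"] rr[of n x] by simp
    ultimately have lower: "0 \<le> h n x" unfolding h_def by (simp add: mult_ac)
    have "h n x \<le> real n * (m n * r n w * s n * x)"
      unfolding h_def using rr[of n x] by (intro mult_left_mono) (auto simp: power_le_one)
    also have "\<dots> \<le> real n * (m n * (s n * w) * s n * x)"
      using x s_nonneg r_w by (intro mult_left_mono mult_right_mono) auto
    also have "\<dots> = (real n * m n * (s n)\<^sup>2) * (w * x)"
      by (simp add: power2_eq_square)
    also have "\<dots> \<le> C * (w * x)"
      using C[of n] x w by (intro mult_right_mono) auto
    finally show ?thesis using lower by simp
  qed
  have lim: "(\<lambda>n. h n x) \<longlonglongrightarrow> 0" if x: "0 < x" for x
  proof (rule Lim_null_comparison)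
    show "(\<lambda>n. real n * (m n * (s n)\<^sup>2 * (w * x))\<^sup>2) \<longlonglongrightarrow> 0" by (rule quadratic_error_tendsto)
    \<comment> \<open>For fixed \<open>x\<close> the cap is eventually inactive, so
      \<open>r n x = s n * x\<close>. The linear terms of \<open>h n x\<close> then cancel and only
      a quadratic remainder is left.\<close>
    have "(\<lambda>n. s n * x) \<longlonglongrightarrow> 0 * x" by (intro tendsto_intros s_tendsto)
    then have "\<forall>\<^sub>F n in sequentially. s n * x < 1" by (rule order_tendstoD) simp
    then show "\<forall>\<^sub>F n in sequentially. norm (h n x) \<le> real n * (m n * (s n)\<^sup>2 * (w * x))\<^sup>2"
    proof eventually_elim
      case (elim n)
      then have rx: "r n x = s n * x" using x s_nonneg[of n] by (simp add: r_eq)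
      have "norm (h n x) = real n * \<bar>(1 - r n w * r n x) ^ m n - (1 - m n * (r n w * r n x))\<bar>"
      proof -
        have "m n * r n w * s n * x - 1 + (1 - r n w * r n x) ^ m n =
            (1 - r n w * r n x) ^ m n - (1 - m n * (r n w * r n x))"
          by (simp add: rx)
        then show ?thesis unfolding h_def real_norm_def abs_mult abs_of_nat by (simp only:)
      qed
      also have "\<dots> \<le> real n * (m n * (r n w * r n x))\<^sup>2"
        by (intro mult_left_mono one_minus_power_Bonferroni rr) simp
      also have "\<dots> \<le> real n * (m n * ((s n * w) * (s n * x)))\<^sup>2"
        using r_bounds[of n] r_w[of n] s_nonneg[of n] x w unfolding rx
        by (intro mult_left_mono power_mono mult_right_mono) auto
      finally show ?case by (simp add: power2_eq_square mult_ac)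
    qed
  qed
  have "(\<lambda>n. \<integral>x. h n x \<partial>F) \<longlonglongrightarrow> (\<integral>x. 0 \<partial>F)"
  proof (rule integral_dominated_convergence)
    show "integrable F (\<lambda>x. C * w * x)" by (intro integrable_mult_right F_int)
    show "AE x in F. (\<lambda>n. h n x) \<longlonglongrightarrow> 0"
      using F_pos by (rule eventually_mono) (rule lim)
    show "AE x in F. norm (h n x) \<le> C * w * x" for n
      using F_pos by (rule eventually_mono) (rule bound)
    show "h n \<in> borel_measurable F" for n unfolding h_def by measurable
  qed simp
  then show ?thesis by (simp add: h_eq)
qed

section \<open>Limits of the mixed binomial generating functions\<close>

text \<open>Reduces a fixed weight \<open>w\<close> to the limit of an explicit exponent: the closed
  form \<open>(1 + z n) ^ m n\<close> tends to \<open>exp L\<close>, and its distance from the sum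
  is controlled by \<open>binomial_pgf_approx\<close>.\<close>

lemma mixed_binomial_pgf_tendsto:
  fixes t L :: complex
  assumes w: "0 < w" and t: "norm t \<le> 1"
    and L: "(\<lambda>n. of_real (m n * r n w) * ((1 - (1 - t) * of_real (s n)) ^ (n - 1) - 1)) \<longlonglongrightarrow> L"
  shows "(\<lambda>n. \<Sum>k\<le>m n. of_real (Bernstein (m n) k (r n w)) *
      (t + (1 - t) * of_real (\<integral>x. (1 - r n x) ^ k \<partial>F)) ^ (n - 1)) \<longlonglongrightarrow> exp L"
proof -
  define b where "b n = 1 - (1 - t) * complex_of_real (s n)" for n
  define z where "z n = of_real (r n w) * (b n ^ (n - 1) - 1)" for n
  have "\<forall>\<^sub>F n in sequentially. s n < 1" using s_tendsto by (rule order_tendstoD) simp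
  then have s1: "\<forall>\<^sub>F n in sequentially. s n \<le> 1" by (rule eventually_mono) simp
  have nb: "norm (b n ^ k) \<le> 1" if "s n \<le> 1" for n k
    using norm_convex_combination_le_1[OF t s_nonneg that] by (simp add: b_def norm_power power_le_one)
  have rw0: "(\<lambda>n. r n w) \<longlonglongrightarrow> 0"
  proof (rule Lim_null_comparison)
    show "\<forall>\<^sub>F n in sequentially. norm (r n w) \<le> s n * w"
      using w by (intro always_eventually) (auto simp: r_bounds intro!: r_le)
    show "(\<lambda>n. s n * w) \<longlonglongrightarrow> 0" by (rule tendsto_mult_left_zero[OF s_tendsto])
  qed
  have closed: "(\<lambda>n. (1 + z n) ^ m n) \<longlonglongrightarrow> exp L"
  proof (rule tendsto_one_plus_power_exp)
    show "z \<longlonglongrightarrow> 0"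
    proof (rule Lim_null_comparison)
      show "\<forall>\<^sub>F n in sequentially. norm (z n) \<le> r n w * 2"
        using s1
      proof eventually_elim
        case (elim n)
        have "norm (b n ^ (n - 1) - 1) \<le> 2"
          using norm_triangle_ineq4[of "b n ^ (n - 1)" 1] nb[OF elim, of "n - 1"] by simp
        then show ?case using r_bounds(1)[of n w] by (simp add: z_def norm_mult mult_left_mono)
      qed
      show "(\<lambda>n. r n w * 2) \<longlonglongrightarrow> 0" by (rule tendsto_mult_left_zero[OF rw0])
    qed
    show "(\<lambda>n. of_nat (m n) * z n) \<longlonglongrightarrow> L"
      using L by (simp add: z_def b_def mult_ac)
    show "\<forall>\<^sub>F n in sequentially. norm (1 + z n) \<le> 1"
      using s1
    proof eventually_elim
      case (elim n)
      show ?case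
        \<comment> \<open>\<open>1 + z n\<close> is a convex combination of 1 and
          \<open>b n ^ (n - 1)\<close>.\<close>
        using norm_convex_combination_le_1[OF nb[OF elim] r_bounds, of "n - 1" n w]
        by (simp add: z_def algebra_simps)
    qed
  qed
  \<comment> \<open>The bound of \<open>binomial_pgf_approx\<close> with \<open>n - 1\<close>
    enlarged to \<open>n\<close> and, in the quadratic term, \<open>r n w\<close> enlarged to
    \<open>s n * w\<close>. The first enlargement uses that the linear error is nonnegative, shown
    below by Bernoulli's inequality.\<close>
  define \<epsilon> where "\<epsilon> n = 2 * (real n * (m n * r n w * s n - 1 + (\<integral>x. (1 - r n w * r n x) ^ m n \<partial>F)))
     + 2 * (real n * (m n * (s n)\<^sup>2 * w)\<^sup>2)" for n
  have \<epsilon>: "\<epsilon> \<longlonglongrightarrow> 0"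
    unfolding \<epsilon>_def
    using tendsto_add[OF tendsto_mult_right_zero[OF linear_error_tendsto[OF w], of 2]
        tendsto_mult_right_zero[OF quadratic_error_tendsto, of 2 w]] by simp
  have "(\<lambda>n. (\<Sum>k\<le>m n. of_real (Bernstein (m n) k (r n w)) *
      (t + (1 - t) * of_real (\<integral>x. (1 - r n x) ^ k \<partial>F)) ^ (n - 1)) - (1 + z n) ^ m n) \<longlonglongrightarrow> 0"
  proof (rule Lim_null_comparison[OF _ \<epsilon>])
    show "\<forall>\<^sub>F n in sequentially. norm ((\<Sum>k\<le>m n. of_real (Bernstein (m n) k (r n w)) *
      (t + (1 - t) * of_real (\<integral>x. (1 - r n x) ^ k \<partial>F)) ^ (n - 1)) - (1 + z n) ^ m n) \<le> \<epsilon> n"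
      using s1
    proof eventually_elim
      case (elim n)
      let ?\<delta> = "m n * r n w * s n - 1 + (\<integral>x. (1 - r n w * r n x) ^ m n \<partial>F)"
      have approx: "norm ((\<Sum>k\<le>m n. of_real (Bernstein (m n) k (r n w)) *
        (t + (1 - t) * of_real (\<integral>x. (1 - r n x) ^ k \<partial>F)) ^ (n - 1)) - (1 + z n) ^ m n)
        \<le> 2 * real (n - 1) * ?\<delta> + 2 * real (n - 1) * (m n * r n w * s n)\<^sup>2"
        unfolding z_def b_def
        by (rule binomial_pgf_approx[OF t r_bounds s_nonneg elim r_bounds r_measurable expectation_r_le])
      have \<delta>: "0 \<le> ?\<delta>"
      proof -
        have rr: "0 \<le> r n w * r n x" "r n w * r n x \<le> 1" for x
          using r_bounds by (auto intro: mult_le_one)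
        have "1 - m n * r n w * expectation (r n) = (\<integral>x. 1 - m n * r n w * r n x \<partial>F)"
          using integrable_r by (simp add: prob_space)
        also have "\<dots> \<le> (\<integral>x. (1 - r n w * r n x) ^ m n \<partial>F)"
        proof (rule integral_mono)
          show "integrable F (\<lambda>x. 1 - m n * r n w * r n x)" using integrable_r by simp
          show "integrable F (\<lambda>x. (1 - r n w * r n x) ^ m n)"
            by (rule integrable_const_bound[where B = 1]) (auto simp: rr power_abs intro!: power_le_one)
          show "1 - m n * r n w * r n x \<le> (1 - r n w * r n x) ^ m n" for x
            using Bernoulli_inequality[of "- (r n w * r n x)" "m n"] rr[of x] by (simp add: mult.assoc)
        qed
        finally show ?thesis
          using mult_left_mono[OF expectation_r_le, of "m n * r n w" n] r_bounds[of n w] by simp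
      qed
      have "2 * real (n - 1) * ?\<delta> \<le> 2 * real n * ?\<delta>"
        using \<delta> by (intro mult_right_mono) auto
      moreover have "2 * real (n - 1) * (m n * r n w * s n)\<^sup>2 \<le> 2 * real n * (m n * (s n * w) * s n)\<^sup>2"
        using r_bounds[of n w] r_le[of w n] w s_nonneg[of n]
        by (intro mult_mono power_mono mult_right_mono mult_left_mono) auto
      ultimately show ?case using approx by (simp add: \<epsilon>_def power2_eq_square mult_ac)
    qed
  qed
  from tendsto_add[OF this closed] show ?thesis by simp
qed

text \<open>The two exponentials mirror the compound Poisson limit: \<open>m n * r n w\<close> tends
  to \<open>\<beta> * \<gamma> * w\<close>, the mean number of groups of \<open>i\<close>, and
  \<open>(n - 1) * s n\<close> tends to \<open>\<gamma>\<close>, the mean number of other vertices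
  in a group.\<close>

lemma mixed_binomial_pgf_critical:
  fixes t :: complex
  assumes "\<alpha> = 1" "0 < w" "norm t \<le> 1"
  shows "(\<lambda>n. \<Sum>k\<le>m n. of_real (Bernstein (m n) k (r n w)) *
      (t + (1 - t) * of_real (\<integral>x. (1 - r n x) ^ k \<partial>F)) ^ (n - 1))
    \<longlonglongrightarrow> exp (of_real (\<beta> * \<gamma> * w) * (exp (of_real \<gamma> * (t - 1)) - 1))"
proof (rule mixed_binomial_pgf_tendsto[OF assms(2,3)])
  have ev: "\<forall>\<^sub>F n in sequentially. s n * x < 1" for x
    by (rule order_tendstoD[OF tendsto_mult_left_zero[OF s_tendsto]]) simp
  have mr: "(\<lambda>n. m n * r n w) \<longlonglongrightarrow> \<beta> * \<gamma> * w"
  proof (rule Lim_transform_eventually)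
    show "(\<lambda>n. m n * s n * w) \<longlonglongrightarrow> \<beta> * \<gamma> * w"
      by (intro tendsto_mult ms_tendsto_critical assms tendsto_const)
    show "\<forall>\<^sub>F n in sequentially. m n * s n * w = m n * r n w"
      using ev[of w] 
    proof eventually_elim
      case (elim n)
      then have "r n w = s n * w" using assms(2) s_nonneg[of n] by (simp add: r_eq)
      then show ?case by simp
    qed
  qed
  have "(\<lambda>n. (1 + (t - 1) * complex_of_real (s n)) ^ (n - 1)) \<longlonglongrightarrow> exp (of_real \<gamma> * (t - 1))"
  proof (rule tendsto_one_plus_power_exp)
    show "(\<lambda>n. (t - 1) * complex_of_real (s n)) \<longlonglongrightarrow> 0"
      using tendsto_mult_right_zero[OF tendsto_of_real[OF s_tendsto, unfolded of_real_0]] .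
    have "(\<lambda>n. n * s n - s n) \<longlonglongrightarrow> \<gamma> - 0"
      by (intro tendsto_diff ns_tendsto_critical s_tendsto assms)
    then have "(\<lambda>n. (n - 1) * s n) \<longlonglongrightarrow> \<gamma>"
      by (rule Lim_transform_eventually[THEN tendsto_eq_rhs])
         (auto intro!: eventually_mono[OF eventually_gt_at_top[of 0]] simp: of_nat_diff algebra_simps)
    then have "(\<lambda>n. of_real ((n - 1) * s n) * (t - 1)) \<longlonglongrightarrow> of_real \<gamma> * (t - 1)"
      by (intro tendsto_intros)
    then show "(\<lambda>n. of_nat (n - 1) * ((t - 1) * complex_of_real (s n))) \<longlonglongrightarrow> of_real \<gamma> * (t - 1)"
      by (simp add: mult_ac)
    show "\<forall>\<^sub>F n in sequentially. norm (1 + (t - 1) * complex_of_real (s n)) \<le> 1"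
      using ev[of 1]
    proof eventually_elim
      case (elim n)
      then show ?case using norm_convex_combination_le_1[OF assms(3) s_nonneg[of n]] by (simp add: algebra_simps)
    qed
  qed
  then have "(\<lambda>n. of_real (m n * r n w) * ((1 + (t - 1) * of_real (s n)) ^ (n - 1) - 1))
     \<longlonglongrightarrow> of_real (\<beta> * \<gamma> * w) * (exp (of_real \<gamma> * (t - 1)) - 1)"
    by (intro tendsto_intros mr)
  then show "(\<lambda>n. of_real (m n * r n w) * ((1 - (1 - t) * of_real (s n)) ^ (n - 1) - 1))
     \<longlonglongrightarrow> of_real (\<beta> * \<gamma> * w) * (exp (of_real \<gamma> * (t - 1)) - 1)"
    by (simp add: algebra_simps)
qed

text \<open>Here \<open>n * s n\<close> tends to 0, so a given group rarely contains another vertex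
  and the inner power can be linearized. The product \<open>m n * r n w * ((n - 1) * s n)\<close>
  keeps the finite limit \<open>\<beta> * \<gamma>\<^sup>2 * w\<close>.\<close>

lemma mixed_binomial_pgf_supercritical:
  fixes t :: complex
  assumes "1 < \<alpha>" "0 < w" "norm t \<le> 1"
  shows "(\<lambda>n. \<Sum>k\<le>m n. of_real (Bernstein (m n) k (r n w)) *
      (t + (1 - t) * of_real (\<integral>x. (1 - r n x) ^ k \<partial>F)) ^ (n - 1))
    \<longlonglongrightarrow> exp (of_real (\<beta> * \<gamma>\<^sup>2 * w) * (t - 1))"
proof (rule mixed_binomial_pgf_tendsto[OF assms(2,3)])
  have ev: "\<forall>\<^sub>F n in sequentially. s n * x < 1" for x
    by (rule order_tendstoD[OF tendsto_mult_left_zero[OF s_tendsto]]) simp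
  have nt: "norm (1 - t) \<le> 2" using norm_triangle_ineq4[of 1 t] assms by simp
  have "(\<lambda>n. (real n * m n * (s n)\<^sup>2 - m n * (s n)\<^sup>2) * w) \<longlonglongrightarrow> (\<beta> * \<gamma>\<^sup>2 - 0) * w"
    by (intro tendsto_mult tendsto_diff nmss_tendsto mss_tendsto tendsto_const)
  then have "(\<lambda>n. m n * r n w * (real (n - 1) * s n)) \<longlonglongrightarrow> \<beta> * \<gamma>\<^sup>2 * w"
  proof (rule Lim_transform_eventually[THEN tendsto_eq_rhs])
    show "\<forall>\<^sub>F n in sequentially. (real n * m n * (s n)\<^sup>2 - m n * (s n)\<^sup>2) * w = m n * r n w * (real (n - 1) * s n)"
      using ev[of w] eventually_gt_at_top[of 0]
    proof eventually_elim
      case (elim n)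
      then have "r n w = s n * w" using assms s_nonneg[of n] by (simp add: r_eq)
      then show ?case using elim by (simp add: of_nat_diff power2_eq_square algebra_simps)
    qed
  qed simp
  then have main: "(\<lambda>n. of_real (m n * r n w * (real (n - 1) * s n)) * (t - 1)) \<longlonglongrightarrow> of_real (\<beta> * \<gamma>\<^sup>2 * w) * (t - 1)"
    by (intro tendsto_mult_right tendsto_of_real)
  \<comment> \<open>The second-order remainder of the power is at most
    \<open>2 * (n * s n)\<^sup>2\<close>; multiplied by \<open>m n * s n * w\<close> it is the
    convergent \<open>n * m n * (s n)\<^sup>2\<close> times the vanishing \<open>n * s n\<close>, up
    to a constant.\<close>
  have err: "(\<lambda>n. of_real (m n * r n w) * ((1 - (1 - t) * of_real (s n)) ^ (n - 1) - 1)
      - of_real (m n * r n w * (real (n - 1) * s n)) * (t - 1)) \<longlonglongrightarrow> 0"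
  proof (rule Lim_null_comparison)
    have "(\<lambda>n. 2 * w * (real n * m n * (s n)\<^sup>2) * (n * s n)) \<longlonglongrightarrow> 2 * w * (\<beta> * \<gamma>\<^sup>2) * 0"
      by (intro tendsto_mult nmss_tendsto ns_tendsto_supercritical assms tendsto_const)
    then show "(\<lambda>n. 2 * w * (real n * m n * (s n)\<^sup>2) * (n * s n)) \<longlonglongrightarrow> 0" by simp
    show "\<forall>\<^sub>F n in sequentially. norm (of_real (m n * r n w) * ((1 - (1 - t) * of_real (s n)) ^ (n - 1) - 1)
      - of_real (m n * r n w * (real (n - 1) * s n)) * (t - 1)) \<le> 2 * w * (real n * m n * (s n)\<^sup>2) * (n * s n)"
      using ev[of 1]
    proof eventually_elim
      case (elim n)
      define y where "y = (1 - t) * complex_of_real (s n)"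
      have y: "norm (1 - y) \<le> 1"
        unfolding y_def using norm_convex_combination_le_1[OF assms(3) s_nonneg[of n]] elim by simp
      have ny: "norm y \<le> 2 * s n"
        using mult_right_mono[OF nt s_nonneg[of n]] s_nonneg[of n] by (simp add: y_def norm_mult)
      have "norm ((1 - y) ^ (n - 1) - (1 - of_nat (n - 1) * y)) \<le> real (n - 1) * (real (n - 1) - 1) / 2 * norm y ^ 2"
        by (rule norm_one_minus_power_bound[OF y])
      also have "\<dots> \<le> (real n * real n / 2) * (2 * s n) ^ 2"
      proof (intro mult_mono power_mono ny)
        show "real (n - 1) * (real (n - 1) - 1) / 2 \<le> real n * real n / 2"
          by (cases "n - 1") (auto intro!: divide_right_mono mult_mono)
      qed auto
      finally have b: "norm ((1 - y) ^ (n - 1) - (1 - of_nat (n - 1) * y)) \<le> 2 * (n * s n)\<^sup>2"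
        by (simp add: power2_eq_square mult_ac)
      have "norm (of_real (m n * r n w) * ((1 - y) ^ (n - 1) - 1)
        - of_real (m n * r n w * (real (n - 1) * s n)) * (t - 1)) =
        norm (of_real (m n * r n w) * ((1 - y) ^ (n - 1) - (1 - of_nat (n - 1) * y)))"
        by (simp add: y_def algebra_simps)
      also have "\<dots> = m n * r n w * norm ((1 - y) ^ (n - 1) - (1 - of_nat (n - 1) * y))"
        unfolding norm_mult norm_of_real using r_bounds[of n w] by simp
      also have "\<dots> \<le> m n * (s n * w) * (2 * (n * s n)\<^sup>2)"
        using assms r_le[of w n] r_bounds[of n w] s_nonneg[of n] b by (intro mult_mono) auto
      finally show ?case by (simp add: y_def power2_eq_square mult_ac)
    qed
  qed
  from tendsto_add[OF err main]
  show "(\<lambda>n. of_real (m n * r n w) * ((1 - (1 - t) * of_real (s n)) ^ (n - 1) - 1))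
     \<longlonglongrightarrow> of_real (\<beta> * \<gamma>\<^sup>2 * w) * (t - 1)" by simp
qed

text \<open>Vertex \<open>i\<close> typically has no group at all. The weight of \<open>i\<close> is
  random here, and the distance from 1 is bounded directly by twice the mean number of its groups,
  hence by \<open>2 * (m n * s n)\<close>, which tends to 0.\<close>

lemma mixed_binomial_pgf_subcritical:
  fixes t :: complex
  assumes "\<alpha> < 1" "norm t \<le> 1"
  shows "(\<lambda>n. \<Sum>k\<le>m n. of_real (\<integral>x. Bernstein (m n) k (r n x) \<partial>F) *
      (t + (1 - t) * of_real (\<integral>x. (1 - r n x) ^ k \<partial>F)) ^ (n - 1)) \<longlonglongrightarrow> 1"
proof -
  have B0: "0 \<le> Bernstein (m n) k (r n x)" for n k x
    by (rule Bernstein_nonneg[OF r_bounds])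
  have B1: "Bernstein (m n) k (r n x) \<le> 1" if "k \<le> m n" for n k x
    using member_le_sum[of k "{..m n}" "\<lambda>k. Bernstein (m n) k (r n x)"] B0 that by simp
  have Bint: "integrable F (\<lambda>x. Bernstein (m n) k (r n x))" if "k \<le> m n" for n k
    using B0 B1[OF that]
    by (intro integrable_const_bound[where B = 1]) (auto simp: Bernstein_def)
  have "norm ((\<Sum>k\<le>m n. of_real (\<integral>x. Bernstein (m n) k (r n x) \<partial>F) *
      (t + (1 - t) * of_real (\<integral>x. (1 - r n x) ^ k \<partial>F)) ^ (n - 1)) - 1) \<le> 2 * (m n * s n)" for n
  proof -
    define g where "g k = t + (1 - t) * complex_of_real (\<integral>x. (1 - r n x) ^ k \<partial>F)" for k
    define p where "p k = (\<integral>x. Bernstein (m n) k (r n x) \<partial>F)" for k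
    have p0: "0 \<le> p k" for k unfolding p_def using B0 by simp
    have "(\<Sum>k\<le>m n. p k) = (\<integral>x. (\<Sum>k\<le>m n. Bernstein (m n) k (r n x)) \<partial>F)"
      unfolding p_def by (intro Bochner_Integration.integral_sum[symmetric] Bint) simp
    then have p_sum: "(\<Sum>k\<le>m n. p k) = 1" by (simp add: prob_space)
    have "(\<Sum>k\<le>m n. k * p k) = (\<integral>x. (\<Sum>k\<le>m n. k * Bernstein (m n) k (r n x)) \<partial>F)"
      unfolding p_def by (subst Bochner_Integration.integral_sum) (auto intro!: Bint)
    then have p_mean: "(\<Sum>k\<le>m n. k * p k) = m n * expectation (r n)" by simp
    have g1: "norm (g k) \<le> 1" for k
    proof -
      have I: "integrable F (\<lambda>x. (1 - r n x) ^ k)"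
        by (rule integrable_const_bound[where B = 1]) (auto simp: r_bounds power_abs intro!: power_le_one)
      have "(\<integral>x. (1 - r n x) ^ k \<partial>F) \<le> (\<integral>x. 1 \<partial>F)"
        by (rule integral_mono[OF I]) (auto simp: r_bounds power_le_one)
      then have le: "(\<integral>x. (1 - r n x) ^ k \<partial>F) \<le> 1" by (simp add: prob_space)
      have ge: "0 \<le> (\<integral>x. (1 - r n x) ^ k \<partial>F)" using r_bounds by simp
      have "g k = 1 - (1 - t) * of_real (1 - (\<integral>x. (1 - r n x) ^ k \<partial>F))"
        by (simp add: g_def algebra_simps)
      also have "norm \<dots> \<le> 1" by (rule norm_convex_combination_le_1[OF assms(2)]) (use le ge in auto)
      finally show ?thesis .
    qed
    \<comment> \<open>At \<open>k = 0\<close> the base is exactly 1, and for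
      \<open>k \<ge> 1\<close> the trivial bound 2 is at most \<open>2 * k\<close>.\<close>
    have gk: "norm (g k ^ (n - 1) - 1) \<le> 2 * k" for k
    proof (cases "k = 0")
      case True
      then show ?thesis by (simp add: g_def prob_space)
    next
      case False
      have "norm (g k ^ (n - 1) - 1) \<le> norm (g k ^ (n - 1)) + norm (1 :: complex)"
        by (rule norm_triangle_ineq4)
      also have "\<dots> \<le> 2" using g1[of k] by (simp add: norm_power power_le_one)
      finally show ?thesis using False by simp
    qed
    have "(\<Sum>k\<le>m n. of_real (p k) * g k ^ (n - 1)) - 1 = (\<Sum>k\<le>m n. of_real (p k) * (g k ^ (n - 1) - 1))"
      using arg_cong[OF p_sum, of complex_of_real] by (simp add: right_diff_distrib sum_subtractf)
    also have "norm \<dots> \<le> (\<Sum>k\<le>m n. p k * (2 * k))"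
      by (intro sum_norm_le) (simp only: norm_mult norm_of_real abs_of_nonneg[OF p0] mult_left_mono[OF gk p0])
    also have "\<dots> = 2 * (\<Sum>k\<le>m n. k * p k)" by (simp add: sum_distrib_left mult_ac)
    also have "\<dots> \<le> 2 * (m n * s n)"
      unfolding p_mean by (intro mult_left_mono expectation_r_le) auto
    finally show ?thesis by (simp add: g_def p_def)
  qed
  then have "(\<lambda>n. (\<Sum>k\<le>m n. of_real (\<integral>x. Bernstein (m n) k (r n x) \<partial>F) *
      (t + (1 - t) * of_real (\<integral>x. (1 - r n x) ^ k \<partial>F)) ^ (n - 1)) - 1) \<longlonglongrightarrow> 0"
    by (intro Lim_null_comparison[OF always_eventually tendsto_mult_right_zero[OF ms_tendsto_subcritical[OF assms(1)], of 2]]) simp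
  then show ?thesis by (subst (asm) LIM_zero_iff)
qed

end

section \<open>Characteristic functions and weak convergence\<close>

lemma prob_space_rig_space:
  assumes "prob_space F" "prob_space Wi"
  shows "prob_space (rig_space F Wi i n m)"
proof -
  interpret P1: prob_space "\<Pi>\<^sub>M j\<in>{1..n}. if j = i then Wi else F"
    by (rule prob_space_PiM) (use assms in auto)
  interpret P2: prob_space "\<Pi>\<^sub>M e\<in>{1..n} \<times> {..<m}. uniform_measure lborel {0..1::real}"
    by (rule prob_space_PiM) (rule prob_space_unit_interval)
  interpret pair_prob_space "\<Pi>\<^sub>M j\<in>{1..n}. if j = i then Wi else F"
    "\<Pi>\<^sub>M e\<in>{1..n} \<times> {..<m}. uniform_measure lborel {0..1::real}" ..
  show ?thesis unfolding rig_space_def by unfold_locales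
qed

lemma iexp_of_nat: "iexp (\<theta> * real k) = iexp \<theta> ^ k"
  by (simp add: exp_of_nat_mult[symmetric] mult_ac)

text \<open>The Poisson generating function at \<open>iexp \<theta>\<close>, summed by the
  exponential series; it is the form in which the supercritical limit appears.\<close>

lemma char_poisson:
  assumes "0 < l"
  shows "char (distr (measure_pmf (poisson_pmf l)) borel real) \<theta> = exp (of_real l * (iexp \<theta> - 1))"
proof -
  let ?p = "measure_pmf (poisson_pmf l)"
  have int: "integrable (count_space UNIV) (\<lambda>k. pmf (poisson_pmf l) k *\<^sub>R iexp \<theta> ^ k)"
  proof (rule Bochner_Integration.integrable_bound[OF integrable_pmf[of UNIV "poisson_pmf l"]])
    show "AE k in count_space UNIV. norm (pmf (poisson_pmf l) k *\<^sub>R iexp \<theta> ^ k) \<le> norm (pmf (poisson_pmf l) k)"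
      by (simp add: norm_mult norm_power)
  qed simp
  have "char (distr ?p borel real) \<theta> = (\<integral>k. iexp \<theta> ^ k \<partial>?p)"
    unfolding char_def by (subst integral_distr) (simp_all only: iexp_of_nat, simp_all)
  also have "\<dots> = (\<integral>k. pmf (poisson_pmf l) k *\<^sub>R iexp \<theta> ^ k \<partial>count_space UNIV)"
    unfolding measure_pmf_eq_density by (subst integral_density) auto
  also have "\<dots> = exp (of_real l * (iexp \<theta> - 1))"
  proof (rule sums_unique2)
    show "(\<lambda>k. pmf (poisson_pmf l) k *\<^sub>R iexp \<theta> ^ k) sums
        (\<integral>k. pmf (poisson_pmf l) k *\<^sub>R iexp \<theta> ^ k \<partial>count_space UNIV)"
      by (rule sums_integral_count_space_nat[OF int])
    have "(\<lambda>k. of_real (exp (- l)) * ((of_real l * iexp \<theta>) ^ k /\<^sub>R fact k)) sums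
        (of_real (exp (- l)) * exp (of_real l * iexp \<theta>))"
      by (intro sums_mult exp_converges)
    also have "of_real (exp (- l)) * exp (of_real l * iexp \<theta>) = exp (of_real l * (iexp \<theta> - 1))"
      by (simp add: exp_of_real[symmetric] exp_add[symmetric] algebra_simps)
    also have "(\<lambda>k. of_real (exp (- l)) * ((of_real l * iexp \<theta>) ^ k /\<^sub>R fact k)) =
        (\<lambda>k. pmf (poisson_pmf l) k *\<^sub>R iexp \<theta> ^ k)"
      using assms by (simp add: fun_eq_iff scaleR_conv_of_real power_mult_distrib field_simps)
    finally show "(\<lambda>k. pmf (poisson_pmf l) k *\<^sub>R iexp \<theta> ^ k) sums exp (of_real l * (iexp \<theta> - 1))" .
  qed
  finally show ?thesis .
qed

lemma weak_conv_m_shift: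
  assumes "weak_conv_m (\<lambda>n. M (n + k)) N"
  shows "weak_conv_m M N"
  using assms unfolding weak_conv_m_def weak_conv_def by (blast intro: LIMSEQ_offset)

context rig_model begin

text \<open>The law is shifted by \<open>i\<close> because for \<open>n < i\<close> the vertex \<open>i\<close> does not exist and
  the degree need not be measurable.\<close>
lemma rig_degree_law_weak_conv:
  assumes Wi: "prob_space Wi" "sets Wi = sets borel" and i: "1 \<le> i" and N: "real_distribution N"
    and pgf: "\<And>\<theta>. (\<lambda>n. \<integral>\<omega>. iexp \<theta> ^ rig_degree \<alpha> \<beta> \<gamma> n i \<omega> \<partial>rig_space F Wi i n (rig_m \<alpha> \<beta> n))
       \<longlonglongrightarrow> char N \<theta>"
  shows "weak_conv_m (rig_degree_law F Wi \<alpha> \<beta> \<gamma> i) N"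
proof (rule weak_conv_m_shift[where k = i], rule levy_continuity[OF _ N])
  fix n
  let ?n = "n + i"
  have D: "(\<lambda>\<omega>. real (rig_degree \<alpha> \<beta> \<gamma> ?n i \<omega>)) \<in> borel_measurable (rig_space F Wi i ?n (rig_m \<alpha> \<beta> ?n))"
    by (rule measurable_compose[OF rig_degree_measurable[OF F_sets Wi(2) i]]) auto
  interpret S: prob_space "rig_space F Wi i ?n (rig_m \<alpha> \<beta> ?n)"
    by (rule prob_space_rig_space[OF prob_space_axioms Wi(1)])
  show "real_distribution (rig_degree_law F Wi \<alpha> \<beta> \<gamma> i ?n)"
    unfolding rig_degree_law_def by (rule S.real_distribution_distr[OF D])
next
  fix \<theta>
  show "(\<lambda>n. char (rig_degree_law F Wi \<alpha> \<beta> \<gamma> i (n + i)) \<theta>) \<longlonglongrightarrow> char N \<theta>"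
  proof (rule Lim_transform_eventually[OF LIMSEQ_ignore_initial_segment[OF pgf, of i]])
    show "\<forall>\<^sub>F n in sequentially. (\<integral>\<omega>. iexp \<theta> ^ rig_degree \<alpha> \<beta> \<gamma> (n + i) i \<omega>
        \<partial>rig_space F Wi i (n + i) (rig_m \<alpha> \<beta> (n + i))) = char (rig_degree_law F Wi \<alpha> \<beta> \<gamma> i (n + i)) \<theta>"
    proof (intro always_eventually allI)
      fix n
      have D: "(\<lambda>\<omega>. real (rig_degree \<alpha> \<beta> \<gamma> (n + i) i \<omega>))
          \<in> borel_measurable (rig_space F Wi i (n + i) (rig_m \<alpha> \<beta> (n + i)))"
        by (rule measurable_compose[OF rig_degree_measurable[OF F_sets Wi(2) i]]) auto
      show "(\<integral>\<omega>. iexp \<theta> ^ rig_degree \<alpha> \<beta> \<gamma> (n + i) i \<omega>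
        \<partial>rig_space F Wi i (n + i) (rig_m \<alpha> \<beta> (n + i))) = char (rig_degree_law F Wi \<alpha> \<beta> \<gamma> i (n + i)) \<theta>"
        unfolding char_def rig_degree_law_def by (subst integral_distr[OF D]) (simp_all only: iexp_of_nat, simp)
    qed
  qed
qed

section \<open>Limits of the degree generating function\<close>

text \<open>Conditioning on the weight \<open>w\<close> of vertex \<open>i\<close> means giving it
  the point mass at \<open>w\<close> as law, which collapses the outer mixture to a plain binomial
  law.\<close>

lemma rig_degree_pgf_fixed_weight:
  fixes t :: complex
  assumes "1 \<le> i" "i \<le> n" "norm t \<le> 1"
  shows "(\<integral>\<omega>. t ^ rig_degree \<alpha> \<beta> \<gamma> n i \<omega> \<partial>rig_space F (return borel w) i n (rig_m \<alpha> \<beta> n)) =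
    (\<Sum>k\<le>m n. of_real (Bernstein (m n) k (r n w)) *
      (t + (1 - t) * of_real (\<integral>x. (1 - r n x) ^ k \<partial>F)) ^ (n - 1))"
proof -
  have "(\<integral>x. Bernstein (m n) k (r n x) \<partial>return borel w) = Bernstein (m n) k (r n w)" for k
    using edge_prob_measurable unfolding Bernstein_def r_def by (intro integral_return) auto
  then show ?thesis
    using rig_degree_pgf[OF prob_space_axioms prob_space_return[of w borel] F_sets sets_return assms,
        of \<alpha> \<beta> \<gamma>] by (simp add: m_def r_def)
qed

lemma rig_degree_pgf_critical:
  fixes t :: complex
  assumes "\<alpha> = 1" "0 < w" "norm t \<le> 1" "1 \<le> i"
  shows "(\<lambda>n. \<integral>\<omega>. t ^ rig_degree \<alpha> \<beta> \<gamma> n i \<omega> \<partial>rig_space F (return borel w) i n (rig_m \<alpha> \<beta> n))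
    \<longlonglongrightarrow> exp (of_real (\<beta> * \<gamma> * w) * (exp (of_real \<gamma> * (t - 1)) - 1))"
  by (rule Lim_transform_eventually[OF mixed_binomial_pgf_critical[OF assms(1-3)]],
      rule eventually_mono[OF eventually_ge_at_top[of i]])
     (rule rig_degree_pgf_fixed_weight[OF assms(4) _ assms(3), symmetric])

lemma rig_degree_pgf_supercritical:
  fixes t :: complex
  assumes "1 < \<alpha>" "0 < w" "norm t \<le> 1" "1 \<le> i"
  shows "(\<lambda>n. \<integral>\<omega>. t ^ rig_degree \<alpha> \<beta> \<gamma> n i \<omega> \<partial>rig_space F (return borel w) i n (rig_m \<alpha> \<beta> n))
    \<longlonglongrightarrow> exp (of_real (\<beta> * \<gamma>\<^sup>2 * w) * (t - 1))"
  by (rule Lim_transform_eventually[OF mixed_binomial_pgf_supercritical[OF assms(1-3)]],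
      rule eventually_mono[OF eventually_ge_at_top[of i]])
     (rule rig_degree_pgf_fixed_weight[OF assms(4) _ assms(3), symmetric])

lemma rig_degree_pgf_subcritical:
  fixes t :: complex
  assumes "\<alpha> < 1" "norm t \<le> 1" "1 \<le> i"
  shows "(\<lambda>n. \<integral>\<omega>. t ^ rig_degree \<alpha> \<beta> \<gamma> n i \<omega> \<partial>rig_space F F i n (rig_m \<alpha> \<beta> n)) \<longlonglongrightarrow> 1"
proof (rule Lim_transform_eventually[OF mixed_binomial_pgf_subcritical[OF assms(1,2)]],
    rule eventually_mono[OF eventually_ge_at_top[of i]])
  fix n assume n: "i \<le> n"
  show "(\<Sum>k\<le>m n. of_real (\<integral>x. Bernstein (m n) k (r n x) \<partial>F) *
      (t + (1 - t) * of_real (\<integral>x. (1 - r n x) ^ k \<partial>F)) ^ (n - 1)) =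
      (\<integral>\<omega>. t ^ rig_degree \<alpha> \<beta> \<gamma> n i \<omega> \<partial>rig_space F F i n (rig_m \<alpha> \<beta> n))"
    unfolding m_def r_def
    by (rule rig_degree_pgf[OF prob_space_axioms prob_space_axioms F_sets F_sets assms(3) n assms(2), symmetric])
qed

end

theorem theorem1p2:
  fixes F :: "real measure" and \<alpha> \<beta> \<gamma> :: real and i :: nat
  assumes F_prob: "prob_space F"
    and F_sets: "sets F = sets borel"
    and F_pos: "AE x in F. 0 < x"
    and F_int: "integrable F (\<lambda>x. x)"
    and F_mean: "(\<integral>x. x \<partial>F) = 1"
    and \<alpha>_pos: "0 < \<alpha>" and \<beta>_pos: "0 < \<beta>" and \<gamma>_pos: "0 < \<gamma>"
    and i_pos: "1 \<le> i"
  shows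
    "(\<alpha> < 1 \<longrightarrow>
        weak_conv_m (rig_degree_law F F \<alpha> \<beta> \<gamma> i) (return borel 0)) \<and>
     (\<alpha> = 1 \<longrightarrow>
        (\<forall>w > 0. \<forall>t \<in> {0..1::real}.
          (\<lambda>n. \<integral>\<omega>. t ^ rig_degree \<alpha> \<beta> \<gamma> n i \<omega>
                  \<partial>rig_space F (return borel w) i n (rig_m \<alpha> \<beta> n))
          \<longlonglongrightarrow> exp (\<beta> * \<gamma> * w * (exp (\<gamma> * (t - 1)) - 1)))) \<and>
     (1 < \<alpha> \<longrightarrow>
        (\<forall>w > 0. weak_conv_m (rig_degree_law F (return borel w) \<alpha> \<beta> \<gamma> i)
            (distr (measure_pmf (poisson_pmf (\<beta> * \<gamma>\<^sup>2 * w))) borel real)))"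
proof (intro conjI impI allI ballI)
  interpret prob_space F by fact
  interpret rig_model F \<alpha> \<beta> \<gamma>
    using assms by unfold_locales
  {
    assume "\<alpha> < 1"
    show "weak_conv_m (rig_degree_law F F \<alpha> \<beta> \<gamma> i) (return borel 0)"
    proof (rule rig_degree_law_weak_conv[OF F_prob F_sets i_pos])
      show "real_distribution (return borel 0)"
        by (simp add: real_distribution_def real_distribution_axioms_def prob_space_return)
      fix \<theta>
      have "char (return borel 0) \<theta> = 1"
        unfolding char_def by (subst integral_return) auto
      then show "(\<lambda>n. \<integral>\<omega>. iexp \<theta> ^ rig_degree \<alpha> \<beta> \<gamma> n i \<omega> \<partial>rig_space F F i n (rig_m \<alpha> \<beta> n))
          \<longlonglongrightarrow> char (return borel 0) \<theta>"
        using rig_degree_pgf_subcritical[OF \<open>\<alpha> < 1\<close> _ i_pos, of "iexp \<theta>"] by simp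
    qed
  next
    fix w t :: real
    assume "\<alpha> = 1" "0 < w" "t \<in> {0..1}"
    \<comment> \<open>The critical limit is available for complex \<open>t\<close> in the unit disc;
      for real \<open>t\<close> both sides are embedded reals, so the real statement can be read
      off.\<close>
    have "(\<lambda>n. complex_of_real (\<integral>\<omega>. t ^ rig_degree \<alpha> \<beta> \<gamma> n i \<omega>
          \<partial>rig_space F (return borel w) i n (rig_m \<alpha> \<beta> n)))
        \<longlonglongrightarrow> of_real (exp (\<beta> * \<gamma> * w * (exp (\<gamma> * (t - 1)) - 1)))"
      using rig_degree_pgf_critical[OF \<open>\<alpha> = 1\<close> \<open>0 < w\<close> _ i_pos, of "of_real t"] \<open>t \<in> {0..1}\<close>
      unfolding integral_complex_of_real[symmetric] by (simp flip: exp_of_real)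
    then show "(\<lambda>n. \<integral>\<omega>. t ^ rig_degree \<alpha> \<beta> \<gamma> n i \<omega>
          \<partial>rig_space F (return borel w) i n (rig_m \<alpha> \<beta> n))
        \<longlonglongrightarrow> exp (\<beta> * \<gamma> * w * (exp (\<gamma> * (t - 1)) - 1))"
      by (simp only: tendsto_of_real_iff)
  next
    fix w :: real
    assume "1 < \<alpha>" "0 < w"
    then have l: "0 < \<beta> * \<gamma>\<^sup>2 * w" using \<beta>_pos \<gamma>_pos by simp
    show "weak_conv_m (rig_degree_law F (return borel w) \<alpha> \<beta> \<gamma> i)
        (distr (measure_pmf (poisson_pmf (\<beta> * \<gamma>\<^sup>2 * w))) borel real)"
    proof (rule rig_degree_law_weak_conv[OF prob_space_return sets_return i_pos])
      show "real_distribution (distr (measure_pmf (poisson_pmf (\<beta> * \<gamma>\<^sup>2 * w))) borel real)"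
        by (rule prob_space.real_distribution_distr[OF measure_pmf.prob_space_axioms]) simp
      fix \<theta>
      show "(\<lambda>n. \<integral>\<omega>. iexp \<theta> ^ rig_degree \<alpha> \<beta> \<gamma> n i \<omega>
          \<partial>rig_space F (return borel w) i n (rig_m \<alpha> \<beta> n))
          \<longlonglongrightarrow> char (distr (measure_pmf (poisson_pmf (\<beta> * \<gamma>\<^sup>2 * w))) borel real) \<theta>"
        unfolding char_poisson[OF l]
        by (rule rig_degree_pgf_supercritical[OF \<open>1 < \<alpha>\<close> \<open>0 < w\<close> _ i_pos]) simp
    qed simp
  }
qed

end
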